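(* The map $\delta^\circ$ is a bijection from $B_n$ to the set of type-B noncrossing arc diagrams on $n$ points.
   Context: $B_n$: signed permutations of $\{\pm1,\ldots,\pm n\}$ ($\pi(-i)=-\pi(i)$), long one-line notation $\pi_{-n}\cdots\pi_{-1}\pi_1\cdots\pi_n$. Symmetric model: $2n$ points on a vertical line labeled $-n,\ldots,-1,1,\ldots,n$ bottom to top, symmetric under the half-turn $x\mapsto -x$ about the origin. An arc: monotone downward curve between labeled points, touching no other labeled point, passing left or right of those between. For $\pi\in B_n$, $\delta(\pi)$ has, for each pair of consecutive positions $a,b$ (order $-n<\cdots<-1<1<\cdots<n$) with $\pi_a>\pi_b$, an arc from $\pi_a$ down to $\pi_b$ passing right of each $\pi_c$ with $\pi_b<\pi_c<\pi_a$, $c$ before $a$, and left of such $\pi_c$ with $c$ after $b$; $\delta(\pi)$ is a centrally symmetric set of non-crossing arcs, a union of symmetric arcs (fixed by the half-turn) and symmetric pairs $\{\alpha,-\alpha\}$. Orbifold model: the orbifold plane is $\mathbb R^2$ modulo $x\sim -x$, pictured as the open upper half-plane together with, for each $r\ge 0$, one "semicircle point" (the closed lower semicircle of radius $r$ about the origin; $r=0$ is the orbifold point $\times$). Numbered points $1,\ldots,n$ lie on the vertical axis above $\times$, in increasing order upward. A type-B arc is one of: an ordinary arc (a curve from numbered $q$ monotone downward to numbered $p<q$, touching no other numbered point, passing left or right of each point between); an orbifold arc (a curve monotone downward from a numbered point $p$ to $\times$, passing left or right of each of $1,\ldots,p-1$); a long arc (a curve containing exactly one semicircle point, which is not $\times$,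 consisting of a left piece descending monotonically from its left endpoint $p$ to the left end of that semicircle and a right piece descending from its right endpoint $q\ne p$ to its right end, the pieces disjoint, each passing left or right of the numbered points below its endpoint). Arcs are up to combinatorial equivalence. A type-B noncrossing arc diagram is a set of type-B arcs that pairwise do not intersect except possibly at numbered endpoints, with no two arcs sharing an endpoint from which both go downward or both go upward. Let $\phi$ map the plane to the orbifold plane: points strictly above the horizontal axis map to themselves, points strictly below map to their negatives, and a point $x$ on the horizontal axis maps to the semicircle point of radius $|x|$. $\phi$ sends each symmetric arc (endpoints $\pm p$) to an orbifold arc with upper endpoint $p$, each non-overlapping symmetric pair to an ordinary arc, and each overlapping symmetric pair to a long arc. Define $\delta^\circ(\pi)=\phi(\delta(\pi))$, a set of type-B arcs. *)

theory Defs
  imports "HOL-Analysis.Analysis" "HOL-Combinatorics.Permutations"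
begin

definition labels :: "nat \<Rightarrow> int set" where
  "labels n = {- int n..int n} - {0}"

definition signed_perms :: "nat \<Rightarrow> (int \<Rightarrow> int) set" where
  "signed_perms n = {\<pi>. \<pi> permutes labels n \<and> (\<forall>i. \<pi> (- i) = - \<pi> i)}"

type_synonym plane = "real \<times> real"

text \<open>The point labeled \<open>i\<close> is drawn at \<open>(0, i)\<close>. A curve that descends monotonically from height
  \<open>q\<close> to height \<open>p\<close> is the graph of a continuous function giving the horizontal coordinate in terms
  of the height.\<close>

definition curve :: "(real \<Rightarrow> real) \<Rightarrow> int \<Rightarrow> int \<Rightarrow> plane set" where
  "curve f q p = {(f y, y) |y. real_of_int p \<le> y \<and> y \<le> real_of_int q}"

text \<open>\<open>descends M q p R f\<close>: the curve of \<open>f\<close> descends from the labeled point \<open>q\<close> to height \<open>p\<close>; of the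
  labeled points (the set \<open>M\<close>) strictly in between it passes right of those in \<open>R\<close> and left of all the
  others. Its lower end is left open, since pieces of long arcs do not end on the vertical axis.\<close>

definition descends :: "int set \<Rightarrow> int \<Rightarrow> int \<Rightarrow> int set \<Rightarrow> (real \<Rightarrow> real) \<Rightarrow> bool" where
  "descends M q p R f \<longleftrightarrow>
     p < q \<and> continuous_on {real_of_int p..real_of_int q} f \<and> f (real_of_int q) = 0 \<and>
     R \<subseteq> M \<inter> {p<..<q} \<and>
     (\<forall>i \<in> M \<inter> {p<..<q}. if i \<in> R then f (real_of_int i) > 0 else f (real_of_int i) < 0)"


section \<open>The symmetric model\<close>

text \<open>An arc up to combinatorial equivalence is a triple \<open>(q, p, R)\<close>: upper endpoint, lower endpoint,
  and the set of labels between them that the arc passes on their right; it passes left of the others.\<close>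

type_synonym sym_arc = "int \<times> int \<times> int set"

fun drawn_sym :: "nat \<Rightarrow> sym_arc \<Rightarrow> plane set \<Rightarrow> bool" where
  "drawn_sym n (q, p, R) C \<longleftrightarrow>
     q \<in> labels n \<and> p \<in> labels n \<and>
     (\<exists>f. descends (labels n) q p R f \<and> f (real_of_int p) = 0 \<and> C = curve f q p)"

fun ends_sym :: "sym_arc \<Rightarrow> int set" where
  "ends_sym (q, p, R) = {q, p}"

definition consecutive :: "nat \<Rightarrow> int \<Rightarrow> int \<Rightarrow> bool" where
  "consecutive n a b \<longleftrightarrow> a \<in> labels n \<and> b \<in> labels n \<and> a < b \<and> labels n \<inter> {a<..<b} = {}"

definition delta :: "nat \<Rightarrow> (int \<Rightarrow> int) \<Rightarrow> sym_arc set" where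
  "delta n \<pi> =
     {(\<pi> a, \<pi> b, {\<pi> c |c. c \<in> labels n \<and> c < a \<and> \<pi> b < \<pi> c \<and> \<pi> c < \<pi> a}) |a b.
        consecutive n a b \<and> \<pi> a > \<pi> b}"

text \<open>A drawing \<open>C\<close> of a set of arcs by curves that do not cross and that is mapped to itself by the
  half-turn \<open>x \<mapsto> - x\<close>.\<close>

definition symmetric_drawing :: "nat \<Rightarrow> sym_arc set \<Rightarrow> (sym_arc \<Rightarrow> plane set) \<Rightarrow> bool" where
  "symmetric_drawing n D C \<longleftrightarrow>
     (\<forall>t \<in> D. drawn_sym n t (C t)) \<and>
     (\<forall>t \<in> D. \<exists>s \<in> D. uminus ` C t = C s) \<and>
     (\<forall>s \<in> D. \<forall>t \<in> D. s \<noteq> t \<longrightarrow>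
        C s \<inter> C t \<subseteq> (\<lambda>i. (0, real_of_int i)) ` (ends_sym s \<inter> ends_sym t))"


section \<open>The orbifold model\<close>

text \<open>\<open>Upper x y\<close> is only used for \<open>y > 0\<close> and \<open>Semicircle r\<close> only for \<open>r \<ge> 0\<close>;
  \<open>Semicircle 0\<close> is the orbifold point.\<close>

datatype orb_point = Upper real real | Semicircle real

fun phi :: "plane \<Rightarrow> orb_point" where
  "phi (x, y) = (if y > 0 then Upper x y else if y < 0 then Upper (- x) (- y) else Semicircle \<bar>x\<bar>)"

text \<open>Type-B arcs up to combinatorial equivalence: \<open>Ordinary q p R\<close> descends from \<open>q\<close> to \<open>p\<close>,
  \<open>Orbifold p R\<close> from \<open>p\<close> to the orbifold point, and \<open>Long p S q R\<close> has left piece from \<open>p\<close> and right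
  piece from \<open>q\<close>. The sets \<open>R\<close> and \<open>S\<close> consist of the numbered points that the respective curve
  (\<open>S\<close>: the left piece, \<open>R\<close>: the right piece) passes on their right.\<close>

datatype typeB_arc =
    Ordinary int int "int set"
  | Orbifold int "int set"
  | Long int "int set" int "int set"

text \<open>\<open>drawn n T A\<close>: the subset \<open>A\<close> of the orbifold plane is a type-B arc in the combinatorial class
  \<open>T\<close>. Curves in the closed upper half-plane are placed in the orbifold plane by \<^const>\<open>phi\<close>, which
  there only glues \<open>(- r, 0)\<close> and \<open>(r, 0)\<close>, the two ends of the semicircle point of radius \<open>r\<close>.\<close>

fun drawn :: "nat \<Rightarrow> typeB_arc \<Rightarrow> orb_point set \<Rightarrow> bool" where
  "drawn n (Ordinary q p R) A \<longleftrightarrow>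
     q \<in> {1..int n} \<and> p \<in> {1..int n} \<and>
     (\<exists>f. descends {1..int n} q p R f \<and> f (real_of_int p) = 0 \<and> A = phi ` curve f q p)"
| "drawn n (Orbifold p R) A \<longleftrightarrow>
     p \<in> {1..int n} \<and>
     (\<exists>f. descends {1..int n} p 0 R f \<and> f 0 = 0 \<and> A = phi ` curve f p 0)"
| "drawn n (Long p S q R) A \<longleftrightarrow>
     p \<in> {1..int n} \<and> q \<in> {1..int n} \<and> p \<noteq> q \<and>
     (\<exists>r f g. r > 0 \<and>
        descends {1..int n} p 0 S f \<and> f 0 = - r \<and>
        descends {1..int n} q 0 R g \<and> g 0 = r \<and>
        curve f p 0 \<inter> curve g q 0 = {} \<and>
        A = phi ` (curve f p 0 \<union> curve g q 0))"

text \<open>The numbered endpoints from which an arc goes downward, respectively upward.\<close>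

fun down_ends :: "typeB_arc \<Rightarrow> int set" where
  "down_ends (Ordinary q p R) = {q}"
| "down_ends (Orbifold p R) = {p}"
| "down_ends (Long p S q R) = {p, q}"

fun up_ends :: "typeB_arc \<Rightarrow> int set" where
  "up_ends (Ordinary q p R) = {p}"
| "up_ends (Orbifold p R) = {}"
| "up_ends (Long p S q R) = {}"

definition ends :: "typeB_arc \<Rightarrow> int set" where
  "ends T = down_ends T \<union> up_ends T"

definition typeB_diagrams :: "nat \<Rightarrow> typeB_arc set set" where
  "typeB_diagrams n =
     {X. \<exists>A. (\<forall>T \<in> X. drawn n T (A T)) \<and>
        (\<forall>S \<in> X. \<forall>T \<in> X. S \<noteq> T \<longrightarrow>
           A S \<inter> A T \<subseteq> (\<lambda>i. Upper 0 (real_of_int i)) ` (ends S \<inter> ends T) \<and>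
           down_ends S \<inter> down_ends T = {} \<and> up_ends S \<inter> up_ends T = {})}"

text \<open>\<open>phi\<close> is applied to the curves in a centrally symmetric noncrossing drawing of \<open>delta n \<pi>\<close>, such
  as the one obtained by joining the points \<open>(a, \<pi> a)\<close> and \<open>(b, \<pi> b)\<close> by a segment for each descent and
  moving each point \<open>(a, \<pi> a)\<close> horizontally to the vertical axis. The resulting combinatorial classes
  do not depend on the drawing, so it is existentially quantified.\<close>

definition delta_orb :: "nat \<Rightarrow> (int \<Rightarrow> int) \<Rightarrow> typeB_arc set" where
  "delta_orb n \<pi> =
     {T. \<exists>C. symmetric_drawing n (delta n \<pi>) C \<and> (\<exists>t \<in> delta n \<pi>. drawn n T (phi ` C t))}"

end

(* A centrally symmetric noncrossing drawing is the full preimage under phi of a type-B drawing, so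
   the theorem reduces to the symmetric model: signed permutations correspond to the centrally
   symmetric noncrossing arc diagrams on the labels.

   Given a noncrossing diagram, "left of" can be extended to a linear order on the labels by inserting
   them from bottom to top; among all compatible permutations, one with the fewest inversions has
   exactly the arcs of the diagram as its descents. It is the only one, since two permutations with the
   same descent arcs cannot differ at a first position. Uniqueness makes the permutation of a centrally
   symmetric diagram signed. Conversely, the descents of a permutation are segments in disjoint vertical
   strips of its plot, which a shear turns into a noncrossing drawing.

   A curve and its half-turn that are disjoint or equal are determined by their common image under phi,
   because a connected set inside the disjoint union of two closed sets lies in one of them. *)

theory Submission
  imports Defs
begin

section \<open>Permutations from noncrossing curves\<close>

text \<open>The obstacle is that \<open>delta_orb\<close> ranges over all drawings, so no drawing
  may change the class of an image. Arcs of the two models are therefore linked by a combinatorial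
  relation: \<open>lifts n T\<close> holds the arcs lying over \<open>T\<close>, two of them or a
  single symmetric one. Every projected curve belongs to a lift of the class of its image, and a
  lift determines its drawable class. Drawability is essential in the last statement. Exchanging the
  two pieces of a long arc yields a label with the same lifts, and only the geometry rules it out:
  the left piece stays left of the right piece at all common heights.\<close>

lemma finite_labels [simp]: "finite (labels n)"
  by (simp add: labels_def)

text \<open>Turns a ranking of the labels into a one-line notation. \<open>N\<close> and
  \<open>M\<close> are kept apart because the induction removes the largest position from
  \<open>N\<close> but the element of largest rank from \<open>M\<close>.\<close>

lemma exists_sorting_bij_betw:
  fixes r :: "'a \<Rightarrow> 'b::linorder" and N :: "'c::linorder set"
  assumes "finite N" "finite M" "card M = card N" "inj_on r M"
  shows "\<exists>\<pi>. bij_betw \<pi> N M \<and> (\<forall>a\<in>N. \<forall>b\<in>N. a < b \<longrightarrow> r (\<pi> a) < r (\<pi> b))"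
  using assms
proof (induction N arbitrary: M rule: finite_linorder_max_induct)
  case empty
  then show ?case by (simp add: bij_betw_def)
next
  case (insert b A)
  have bA: "b \<notin> A" using insert.hyps(2) by auto
  then have "card M = Suc (card A)" using insert.prems(2) insert.hyps(1) by simp
  then have "M \<noteq> {}" by auto
  then have "Max (r ` M) \<in> r ` M" using insert.prems(1) by simp
  then obtain x where x: "x \<in> M" "Max (r ` M) = r x" by auto
  have lt: "r y < r x" if "y \<in> M - {x}" for y
  proof -
    have "r y \<le> r x" using x(2) that insert.prems(1) by (metis DiffD1 Max_ge finite_imageI imageI)
    moreover have "r y \<noteq> r x" using that x(1) insert.prems(3) by (auto dest: inj_onD)
    ultimately show ?thesis by simp
  qed
  have "card (M - {x}) = card A" using \<open>card M = Suc (card A)\<close> x(1) insert.prems(1) by simp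
  then obtain \<pi> where \<pi>: "bij_betw \<pi> A (M - {x})"
      "\<forall>a\<in>A. \<forall>b\<in>A. a < b \<longrightarrow> r (\<pi> a) < r (\<pi> b)"
    using insert.IH[of "M - {x}"] insert.prems by (meson finite_Diff inj_on_diff)
  have "bij_betw (\<pi>(b := x)) (insert b A) M"
  proof -
    have "bij_betw (\<pi>(b := x)) A (M - {x})"
      using \<pi>(1) bA by (subst bij_betw_cong[where g = \<pi>]) auto
    from notIn_Un_bij_betw[of b A "\<pi>(b := x)" "M - {x}"] this bA x(1)
    show ?thesis by (simp add: insert_absorb)
  qed
  moreover have "r ((\<pi>(b := x)) a) < r ((\<pi>(b := x)) c)" if "a \<in> insert b A" "c \<in> insert b A" "a < c" for a c
  proof -
    have "a \<in> A" "a \<noteq> b" using that insert.hyps(2) by force+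
    moreover have "\<pi> a \<in> M - {x}" using \<pi>(1) \<open>a \<in> A\<close> by (auto dest: bij_betwE)
    ultimately show ?thesis using that \<pi>(2) lt by auto
  qed
  ultimately show ?case by blast
qed

text \<open>Discrete intermediate value argument: \<open>j\<close> is the first place after
  \<open>a\<close> where \<open>P\<close> fails and \<open>i\<close> is the label just before it.
  With \<open>P\<close> saying that an entry lies above a threshold, the step is a descent across
  that threshold.\<close>

lemma exists_consecutive_step:
  assumes "a \<in> labels n" "b \<in> labels n" "a < b" "P a" "\<not> P b"
  obtains i j where "consecutive n i j" "a \<le> i" "j \<le> b" "P i" "\<not> P j"
proof -
  define J where "J = {j \<in> labels n. a < j \<and> \<not> P j}"
  define j where "j = Min J"
  have J: "finite J" "b \<in> J" using assms by (auto simp: J_def)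
  then have jJ: "j \<in> J" unfolding j_def by (metis Min_in empty_iff)
  have jb: "j \<le> b" using J by (simp add: j_def)
  define I where "I = {i \<in> labels n. a \<le> i \<and> i < j}"
  define i where "i = Max I"
  have I: "finite I" "a \<in> I" using assms(1) jJ by (auto simp: I_def J_def)
  then have iI: "i \<in> I" unfolding i_def by (metis Max_in empty_iff)
  have "P i"
  proof (rule ccontr)
    assume "\<not> P i"
    then have "i \<in> J" using iI assms(4) by (auto simp: I_def J_def order.order_iff_strict)
    then have "j \<le> i" using J(1) by (simp add: j_def)
    then show False using iI by (simp add: I_def)
  qed
  moreover have "labels n \<inter> {i<..<j} = {}"
  proof -
    have "k \<notin> labels n" if "i < k" "k < j" for k
    proof
      assume "k \<in> labels n"
      then have "k \<in> I" using that iI by (auto simp: I_def)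
      then have "k \<le> i" using I(1) by (simp add: i_def)
      then show False using that by simp
    qed
    then show ?thesis by auto
  qed
  then have "consecutive n i j" using iI jJ by (auto simp: consecutive_def I_def J_def)
  ultimately show thesis using that iI jJ jb by (auto simp: I_def J_def)
qed

lemma obtains_Max_image:
  fixes f :: "'a \<Rightarrow> 'b::linorder"
  assumes "finite P" "P \<noteq> {}"
  obtains x where "x \<in> P" "\<And>y. y \<in> P \<Longrightarrow> f y \<le> f x"
proof -
  have "Max (f ` P) \<in> f ` P" using assms by simp
  then obtain x where "x \<in> P" "Max (f ` P) = f x" by auto
  then show thesis using that[of x] assms by (metis Max_ge finite_imageI imageI)
qed

text \<open>Curves are horizontal coordinates as functions of height, so a crossing is an equality
  of values at a common height. Arcs may meet end to end, top on bottom, but the uniqueness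
  assumptions forbid two tops or two bottoms at one label.\<close>

locale noncrossing_curves =
  fixes n :: nat and D :: "sym_arc set" and F :: "sym_arc \<Rightarrow> real \<Rightarrow> real"
  assumes ends_in: "(q, p, R) \<in> D \<Longrightarrow> q \<in> labels n \<and> p \<in> labels n"
    and desc: "(q, p, R) \<in> D \<Longrightarrow> descends (labels n) q p R (F (q, p, R))"
    and bottom_zero: "(q, p, R) \<in> D \<Longrightarrow> F (q, p, R) (real_of_int p) = 0"
    and cross: "\<lbrakk>(q, p, R) \<in> D; (q', p', R') \<in> D; (q, p, R) \<noteq> (q', p', R');
       real_of_int p \<le> y; y \<le> real_of_int q; real_of_int p' \<le> y; y \<le> real_of_int q';
       F (q, p, R) y = F (q', p', R') y\<rbrakk> \<Longrightarrow> y \<in> real_of_int ` ({q, p} \<inter> {q', p'})"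
    and top_unique: "\<lbrakk>(q, p, R) \<in> D; (q, p', R') \<in> D\<rbrakk> \<Longrightarrow> p = p' \<and> R = R'"
    and bottom_unique: "\<lbrakk>(q, p, R) \<in> D; (q', p, R') \<in> D\<rbrakk> \<Longrightarrow> q = q' \<and> R = R'"
begin

section \<open>Left-to-right order of noncrossing curves\<close>

lemma top_zero: "(q, p, R) \<in> D \<Longrightarrow> F (q, p, R) (real_of_int q) = 0"
  using desc by (auto simp: descends_def)

lemma bottom_less_top: "(q, p, R) \<in> D \<Longrightarrow> p < q"
  using desc by (auto simp: descends_def)

lemma side_iff:
  assumes "(q, p, R) \<in> D" "c \<in> labels n" "p < c" "c < q"
  shows "c \<in> R \<longleftrightarrow> F (q, p, R) (real_of_int c) > 0" "c \<notin> R \<longleftrightarrow> F (q, p, R) (real_of_int c) < 0"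
proof -
  have "if c \<in> R then F (q, p, R) (real_of_int c) > 0 else F (q, p, R) (real_of_int c) < 0"
    using desc[OF assms(1)] assms(2-) by (auto simp: descends_def)
  then show "c \<in> R \<longleftrightarrow> F (q, p, R) (real_of_int c) > 0" "c \<notin> R \<longleftrightarrow> F (q, p, R) (real_of_int c) < 0"
    by (auto split: if_splits)
qed

lemma in_side: "(q, p, R) \<in> D \<Longrightarrow> c \<in> R \<Longrightarrow> c \<in> labels n \<and> p < c \<and> c < q"
  using desc unfolding descends_def by (meson IntD1 IntD2 greaterThanLessThan_iff subset_eq)

text \<open>A change of order would give, by the intermediate value theorem, a common point strictly
  between the heights \<open>y\<close> and \<open>z\<close>, hence interior to both curves, where
  \<open>cross\<close> allows none. The conclusion is weak because the curves may share an end at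
  height \<open>z\<close>.\<close>

lemma order_preserved:
  assumes s: "(q, p, R) \<in> D" and t: "(q', p', R') \<in> D"
    and y: "real_of_int p \<le> y" "y \<le> real_of_int q" "real_of_int p' \<le> y" "y \<le> real_of_int q'"
    and z: "real_of_int p \<le> z" "z \<le> real_of_int q" "real_of_int p' \<le> z" "z \<le> real_of_int q'"
    and less: "F (q, p, R) y < F (q', p', R') y"
  shows "F (q, p, R) z \<le> F (q', p', R') z"
proof (rule ccontr)
  assume neg: "\<not> ?thesis"
  define h where "h = (\<lambda>w. F (q', p', R') w - F (q, p, R) w)"
  have cont: "continuous_on {real_of_int p..real_of_int q} (F (q, p, R))"
    "continuous_on {real_of_int p'..real_of_int q'} (F (q', p', R'))"
    using desc[OF s] desc[OF t] by (auto simp: descends_def)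
  define S where "S = {min y z..max y z}"
  have S: "S \<subseteq> {real_of_int p..real_of_int q}" "S \<subseteq> {real_of_int p'..real_of_int q'}"
    using y z by (auto simp: S_def)
  have "connected (h ` S)"
    unfolding h_def S_def
    by (intro connected_continuous_image continuous_intros connected_Icc
        continuous_on_subset[OF cont(1) S(1)[unfolded S_def]]
        continuous_on_subset[OF cont(2) S(2)[unfolded S_def]])
  moreover have "h z \<in> h ` S" "h y \<in> h ` S" by (auto simp: S_def)
  moreover have "h z \<le> 0" "0 \<le> h y" using neg less by (auto simp: h_def)
  ultimately have "0 \<in> h ` S" by (meson connectedD_interval)
  then obtain w where w: "w \<in> S" "h w = 0" by auto
  have ne: "(q, p, R) \<noteq> (q', p', R')" using less by auto
  have "w \<in> real_of_int ` ({q, p} \<inter> {q', p'})"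
    using cross[OF s t ne, of w] w(2) subsetD[OF S(1) w(1)] subsetD[OF S(2) w(1)] by (auto simp: h_def)
  moreover have "w \<noteq> y" "w \<noteq> z" using w(2) less neg by (auto simp: h_def)
  then have "min y z < w" "w < max y z" using w(1) by (auto simp: S_def)
  then have "real_of_int p < w" "w < real_of_int q" using y z by linarith+
  ultimately show False by auto
qed

text \<open>The higher bottom lies at a height covered by the other curve. The curve ending there
  has coordinate 0, so the preserved order decides on which side the other one passes. It cannot be
  the top of the other curve: at the only common height both values would then be 0, against
  \<open>less\<close>.\<close>

lemma bottoms_ordered:
  assumes s: "(q, p, R) \<in> D" and t: "(q', p', R') \<in> D"
    and y: "real_of_int p \<le> y" "y \<le> real_of_int q" "real_of_int p' \<le> y" "y \<le> real_of_int q'"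
    and less: "F (q, p, R) y < F (q', p', R') y"
  shows "p < p' \<Longrightarrow> p' < q \<and> p' \<notin> R" "p' < p \<Longrightarrow> p < q' \<and> p \<in> R'"
proof -
  show "p' < q \<and> p' \<notin> R" if "p < p'"
  proof -
    have "F (q, p, R) (real_of_int p') \<le> 0"
      using order_preserved[OF s t y, of "real_of_int p'"] less that y bottom_zero[OF t] by simp
    moreover have "p' \<noteq> q"
    proof
      assume "p' = q"
      then have "y = real_of_int q" "y = real_of_int p'" using y by auto
      then show False using less bottom_zero[OF t] top_zero[OF s] by simp
    qed
    moreover have "p' \<le> q" using y by linarith
    ultimately show ?thesis using side_iff[OF s, of p'] ends_in[OF t] that by force
  qed
  show "p < q' \<and> p \<in> R'" if "p' < p"
  proof -
    have "0 \<le> F (q', p', R') (real_of_int p)"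
      using order_preserved[OF s t y, of "real_of_int p"] less that y bottom_zero[OF s] by simp
    moreover have "p \<noteq> q'"
    proof
      assume "p = q'"
      then have "y = real_of_int q'" "y = real_of_int p" using y by auto
      then show False using less bottom_zero[OF s] top_zero[OF t] by simp
    qed
    moreover have "p \<le> q'" using y by linarith
    ultimately show ?thesis using side_iff[OF t, of p] ends_in[OF s] that by force
  qed
qed

text \<open>\<open>r c\<close> is the left-to-right place of \<open>c\<close> among the labels
  \<open>A\<close> inserted so far. While the top \<open>q\<close> of an arc is missing, the arc is
  represented by its bottom \<open>p\<close>, with which the labels it passes are compared. Once
  present, \<open>q\<close> has to lie before \<open>p\<close> and after the labels left of the arc.
  Real values leave room for later insertions.\<close>

definition ranks :: "int set \<Rightarrow> (int \<Rightarrow> real) \<Rightarrow> bool" where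
  "ranks A r \<longleftrightarrow> inj_on r A \<and>
    (\<forall>q p R. (q, p, R) \<in> D \<longrightarrow> p \<in> A \<longrightarrow>
      (\<forall>c\<in>A. p < c \<longrightarrow> c < q \<longrightarrow> (if c \<in> R then r c < r p else r p < r c)) \<and>
      (q \<in> A \<longrightarrow> r q < r p \<and> (\<forall>c\<in>R \<inter> A. r c < r q)))"

text \<open>If the bottoms differ, the higher one is a label passed by the other curve, and
  \<open>ranks\<close> compares it with the bottom of that curve. Equal bottoms would mean equal
  arcs.\<close>

lemma ranks_bottoms:
  assumes "ranks A r" and s: "(q, p, R) \<in> D" and t: "(q', p', R') \<in> D" and "p \<in> A" "p' \<in> A"
    and y: "real_of_int p \<le> y" "y \<le> real_of_int q" "real_of_int p' \<le> y" "y \<le> real_of_int q'"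
    and less: "F (q, p, R) y < F (q', p', R') y"
  shows "r p < r p'"
proof (cases p p' rule: linorder_cases)
  case less': less
  then show ?thesis using bottoms_ordered(1)[OF s t y less] assms unfolding ranks_def by meson
next
  case equal
  then show ?thesis using bottom_unique s t less by blast
next
  case greater
  then show ?thesis using bottoms_ordered(2)[OF s t y less] assms unfolding ranks_def by meson
qed

text \<open>Labels are ranked from bottom to top. A new label \<open>x\<close> has to come after the bottoms of the curves
  passing left of it and after the labels left of the curve ending at \<open>x\<close>, and before the bottoms of
  that curve and of the curves passing right of it.\<close>

lemma ranks_insert:
  assumes r: "ranks A r" and fin: "finite A" and x: "\<forall>a\<in>A. a < x" "x \<in> labels n" and A: "A \<subseteq> labels n"
  shows "\<exists>r. ranks (insert x A) r"
proof -
  define L where "L = {p \<in> A. \<exists>q R. (q, p, R) \<in> D \<and> x < q \<and> x \<notin> R} \<union>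
     {c \<in> A. \<exists>p R. (x, p, R) \<in> D \<and> p \<in> A \<and> c \<in> R}"
  define U where "U = {p \<in> A. \<exists>q R. (q, p, R) \<in> D \<and> x < q \<and> x \<in> R} \<union>
     {p \<in> A. \<exists>R. (x, p, R) \<in> D}"
  \<comment> \<open>Each bound comes from a curve reaching height \<open>x\<close>, so comparing a
    lower with an upper bound amounts to comparing two curves at that height.\<close>
  have LU: "r l < r u" if l: "l \<in> L" and u: "u \<in> U" for l u
  proof -
    have lA: "l \<in> A" and uA: "u \<in> A" using l u by (auto simp: L_def U_def)
    have lx: "l < x" "u < x" using lA uA x by auto
    have Uright: "(\<exists>q R. (q, u, R) \<in> D \<and> x < q \<and> x \<in> R \<and> F (q, u, R) (real_of_int x) > 0) \<or> (\<exists>R. (x, u, R) \<in> D)"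
    proof -
      have "F (q, u, R) (real_of_int x) > 0" if "(q, u, R) \<in> D" "x < q" "x \<in> R" for q R
        using side_iff[of q u R x] that x lx by blast
      then show ?thesis using u by (auto simp: U_def)
    qed
    consider (pass) q R where "(q, l, R) \<in> D" "x < q" "x \<notin> R"
      | (left) p R where "(x, p, R) \<in> D" "p \<in> A" "l \<in> R"
      using l by (auto simp: L_def)
    then show ?thesis
    proof cases
      case pass
      have neg: "F (q, l, R) (real_of_int x) < 0"
        using side_iff(2)[OF pass(1) x(2) lx(1) pass(2)] pass(3) by simp
      \<comment> \<open>A curve with top \<open>x\<close> has coordinate 0 at this height, so both
        kinds of upper bound come from a curve with nonnegative coordinate there.\<close>
      obtain q' R' where t: "(q', u, R') \<in> D" "x \<le> q'" "F (q', u, R') (real_of_int x) \<ge> 0"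
        using Uright top_zero by (metis less_eq_real_def order_refl less_imp_le)
      show ?thesis
        using ranks_bottoms[OF r pass(1) t(1) lA uA, of "real_of_int x"] pass t neg lx by auto
    next
      case left
      have lp: "p < l" "l \<in> labels n" using in_side[OF left(1)] left(3) by auto
      have rlp: "r l < r p"
        using r left lA lp lx unfolding ranks_def by meson
      \<comment> \<open>Being left of the curve from \<open>x\<close>, the label \<open>l\<close>
        already precedes its bottom \<open>p\<close>; it remains to compare \<open>p\<close> with
        \<open>u\<close>.\<close>
      from Uright show ?thesis
      proof
        assume "\<exists>R. (x, u, R) \<in> D"
        then show ?thesis using top_unique left(1) rlp by blast
      next
        assume "\<exists>q R. (q, u, R) \<in> D \<and> x < q \<and> x \<in> R \<and> 0 < F (q, u, R) (real_of_int x)"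
        then obtain q' R' where t: "(q', u, R') \<in> D" "x < q'" "0 < F (q', u, R') (real_of_int x)" by auto
        have "p < x" using bottom_less_top left(1) by blast
        then have "r p < r u"
          using ranks_bottoms[OF r left(1) t(1) left(2) uA, of "real_of_int x"] t lx
          by (simp add: top_zero[OF left(1)])
        then show ?thesis using rlp by simp
      qed
    qed
  qed
  have finLU: "finite (r ` L)" "finite (r ` U)" using fin by (auto simp: L_def U_def)
  \<comment> \<open>A missing bound is replaced by one at distance 1, so that the interval is
    nonempty in every case.\<close>
  obtain lo hi where lohi: "lo < hi" "\<And>l. l \<in> L \<Longrightarrow> r l \<le> lo" "\<And>u. u \<in> U \<Longrightarrow> hi \<le> r u"
  proof (cases "L = {}")
    case True
    show thesis
    proof (cases "U = {}")
      case True
      then show thesis using that[of 0 1] \<open>L = {}\<close> by auto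
    next
      case False
      obtain hi where hi: "hi = Min (r ` U)" by simp
      then have "hi \<le> r u" if "u \<in> U" for u using that finLU by simp
      then show thesis using that[of "hi - 1" hi] True by auto
    qed
  next
    case False
    then have MaxL: "Max (r ` L) \<in> r ` L" using finLU by auto
    show thesis
    proof (cases "U = {}")
      case True
      then show thesis using that[of "Max (r ` L)" "Max (r ` L) + 1"] finLU by auto
    next
      case U: False
      then have "Min (r ` U) \<in> r ` U" using finLU by auto
      then have "Max (r ` L) < Min (r ` U)" using MaxL LU by auto
      then show thesis using that[of "Max (r ` L)" "Min (r ` U)"] finLU by auto
    qed
  qed
  \<comment> \<open>Avoiding the finitely many ranks in use keeps the ranking injective.\<close>
  have "infinite ({lo<..<hi} - r ` A)" using fin lohi(1) by (simp add: Diff_infinite_finite)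
  then obtain v where v: "lo < v" "v < hi" "v \<notin> r ` A"
    by (metis DiffE finite.emptyI ex_in_conv greaterThanLessThan_iff)
  define r' where "r' = r(x := v)"
  have xA: "x \<notin> A" using x by auto
  have r'A: "r' a = r a" if "a \<in> A" for a using that xA by (auto simp: r'_def)
  have r'x: "r' x = v" by (simp add: r'_def)
  have Lv: "r l < v" if "l \<in> L" for l using lohi(2)[OF that] v by simp
  have Uv: "v < r u" if "u \<in> U" for u using lohi(3)[OF that] v by simp
  have "ranks (insert x A) r'"
    unfolding ranks_def
  proof (intro conjI allI impI ballI)
    have "inj_on r' A" using r r'A unfolding ranks_def by (metis inj_on_cong)
    moreover have "r' x \<notin> r' ` A" using v r'A r'x by auto
    ultimately show "inj_on r' (insert x A)" using xA by simp
  next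
    fix q p R c
    assume s: "(q, p, R) \<in> D" and p: "p \<in> insert x A" and c: "c \<in> insert x A" "p < c" "c < q"
    then have pA: "p \<in> A" using x by auto
    show "if c \<in> R then r' c < r' p else r' p < r' c"
    proof (cases "c = x")
      case True
      then have "if x \<in> R then p \<in> U else p \<in> L" using s pA c by (auto simp: L_def U_def)
      then show ?thesis using True Lv Uv r'A pA r'x by (auto split: if_splits)
    next
      case False
      then have cA: "c \<in> A" using c by simp
      have "if c \<in> R then r c < r p else r p < r c" using r s pA cA c unfolding ranks_def by blast
      then show ?thesis using r'A cA pA by simp
    qed
  next
    fix q p R
    assume s: "(q, p, R) \<in> D" and p: "p \<in> insert x A" and q: "q \<in> insert x A"
    have pq: "p < q" using bottom_less_top[OF s] .
    then have pA: "p \<in> A" using x p q by auto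
    show "r' q < r' p"
    proof (cases "q = x")
      case True
      then have "p \<in> U" using s pA by (auto simp: U_def)
      then show ?thesis using True Uv r'A pA r'x by simp
    next
      case False
      then show ?thesis using r s pA q r'A unfolding ranks_def by simp
    qed
  next
    fix q p R c
    assume s: "(q, p, R) \<in> D" and p: "p \<in> insert x A" and q: "q \<in> insert x A" and c: "c \<in> R \<inter> insert x A"
    have pq: "p < q" using bottom_less_top[OF s] .
    then have pA: "p \<in> A" using x p q by auto
    have "c < q" using in_side[OF s] c by auto
    then have cA: "c \<in> A" using x q c by auto
    show "r' c < r' q"
    proof (cases "q = x")
      case True
      then have "c \<in> L" using s pA cA c by (auto simp: L_def)
      then show ?thesis using True Lv r'A cA r'x by simp
    next
      case False
      then have "q \<in> A" using q by simp
      then show ?thesis using r s pA r'A c cA unfolding ranks_def by (metis IntI IntD1)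
    qed
  qed
  then show ?thesis by blast
qed

lemma exists_ranks: "\<exists>r. ranks (labels n) r"
proof -
  have "A \<subseteq> labels n \<longrightarrow> (\<exists>r. ranks A r)" if "finite A" for A
    using that
  proof (induction A rule: finite_linorder_max_induct)
    case empty
    show ?case by (simp add: ranks_def)
  next
    case (insert x A)
    then show ?case using ranks_insert by (metis insert_subset)
  qed
  then show ?thesis by simp
qed

text \<open>Here \<open>inv \<pi> v\<close> is the position of the value \<open>v\<close>. The
  condition is what holds for a descent arc of \<open>\<pi>\<close>, except that the positions of
  \<open>q\<close> and \<open>p\<close> need not be consecutive.\<close>

definition compatible :: "(int \<Rightarrow> int) \<Rightarrow> bool" where
  "compatible \<pi> \<longleftrightarrow> (\<forall>q p R. (q, p, R) \<in> D \<longrightarrow> inv \<pi> q < inv \<pi> p \<and>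
     (\<forall>c\<in>labels n. p < c \<longrightarrow> c < q \<longrightarrow> (if c \<in> R then inv \<pi> c < inv \<pi> q else inv \<pi> p < inv \<pi> c)))"

lemma exists_compatible: "\<exists>\<pi>. \<pi> permutes labels n \<and> compatible \<pi>"
proof -
  obtain r where r: "ranks (labels n) r" using exists_ranks by blast
  then have "inj_on r (labels n)" by (simp add: ranks_def)
  then obtain \<rho> where \<rho>: "bij_betw \<rho> (labels n) (labels n)"
      "\<forall>a\<in>labels n. \<forall>b\<in>labels n. a < b \<longrightarrow> r (\<rho> a) < r (\<rho> b)"
    using exists_sorting_bij_betw[of "labels n" "labels n" r] by auto
  define \<pi> where "\<pi> = (\<lambda>x. if x \<in> labels n then \<rho> x else x)"
  have "bij_betw \<pi> (labels n) (labels n)"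
    using \<rho>(1) by (subst bij_betw_cong[where g = \<rho>]) (auto simp: \<pi>_def)
  then have perm: "\<pi> permutes labels n" by (rule bij_imp_permutes) (simp add: \<pi>_def)
  have pos: "inv \<pi> u < inv \<pi> v" if "u \<in> labels n" "v \<in> labels n" "r u < r v" for u v
  proof (rule ccontr)
    assume "\<not> ?thesis"
    moreover have in_l: "inv \<pi> u \<in> labels n" "inv \<pi> v \<in> labels n"
      using perm that by (auto simp: permutes_in_image permutes_inv)
    moreover have "\<rho> (inv \<pi> w) = w" if "w \<in> labels n" for w
      using permutes_inverses(1)[OF perm, of w] that perm in_l
      by (metis \<pi>_def permutes_in_image permutes_inv)
    ultimately show False using \<rho>(2) that by (metis linorder_neqE order_less_asym)
  qed
  have "compatible \<pi>"
    unfolding compatible_def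
  proof (intro allI impI conjI ballI)
    fix q p R assume s: "(q, p, R) \<in> D"
    have qp: "q \<in> labels n" "p \<in> labels n" using ends_in[OF s] by auto
    show "inv \<pi> q < inv \<pi> p" using pos qp r s unfolding ranks_def by meson
    fix c assume c: "c \<in> labels n" "p < c" "c < q"
    have "c \<in> R \<longrightarrow> r c < r q" "c \<notin> R \<longrightarrow> r p < r c"
      using r s qp c unfolding ranks_def by (metis IntI)+
    then show "if c \<in> R then inv \<pi> c < inv \<pi> q else inv \<pi> p < inv \<pi> c"
      using pos qp c by simp
  qed
  then show ?thesis using perm by blast
qed

text \<open>The swap only reverses the order of \<open>\<pi> a\<close> and \<open>\<pi> b\<close>. A
  constraint asking for the larger value \<open>\<pi> a\<close> first can only be the one between
  the two ends of an arc, which \<open>notin\<close> excludes; all other constraints put the smaller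
  value first.\<close>

lemma compatible_transpose:
  assumes perm: "\<pi> permutes labels n" and comp: "compatible \<pi>" and ab: "consecutive n a b"
    and desc: "\<pi> b < \<pi> a" and notin: "\<And>R. (\<pi> a, \<pi> b, R) \<notin> D"
  shows "compatible (\<pi> \<circ> Transposition.transpose a b)"
proof -
  have inv: "inv (\<pi> \<circ> Transposition.transpose a b) = Transposition.transpose a b \<circ> inv \<pi>"
    using perm by (simp add: o_inv_distrib permutes_bij)
  have ab': "a \<in> labels n" "b \<in> labels n" "a < b" "\<And>c. c \<in> labels n \<Longrightarrow> c \<le> a \<or> b \<le> c"
    using ab by (force simp: consecutive_def)+
  have keep: "inv (\<pi> \<circ> Transposition.transpose a b) u < inv (\<pi> \<circ> Transposition.transpose a b) v"
    if "u \<in> labels n" "v \<in> labels n" "inv \<pi> u < inv \<pi> v" "\<not> (u = \<pi> a \<and> v = \<pi> b)" for u v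
  proof -
    have "inv \<pi> u \<in> labels n" "inv \<pi> v \<in> labels n"
      using perm that by (auto simp: permutes_in_image permutes_inv)
    moreover have "\<not> (inv \<pi> u = a \<and> inv \<pi> v = b)" using that(4) permutes_inverses(1)[OF perm] by metis
    ultimately show ?thesis using that(3) ab'(3) ab'(4)[of "inv \<pi> u"] ab'(4)[of "inv \<pi> v"]
      unfolding inv by (auto simp: Transposition.transpose_def)
  qed
  show ?thesis
    unfolding compatible_def
  proof (intro allI impI conjI ballI)
    fix q p R assume s: "(q, p, R) \<in> D"
    have qp: "q \<in> labels n" "p \<in> labels n" using ends_in[OF s] by auto
    show "inv (\<pi> \<circ> Transposition.transpose a b) q < inv (\<pi> \<circ> Transposition.transpose a b) p"
      using keep[OF qp] comp s notin unfolding compatible_def by blast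
    fix c assume c: "c \<in> labels n" "p < c" "c < q"
    show "if c \<in> R then inv (\<pi> \<circ> Transposition.transpose a b) c < inv (\<pi> \<circ> Transposition.transpose a b) q
        else inv (\<pi> \<circ> Transposition.transpose a b) p < inv (\<pi> \<circ> Transposition.transpose a b) c"
      using keep[OF c(1) qp(1)] keep[OF qp(2) c(1)] comp s c desc unfolding compatible_def
      by (smt (verit, ccfv_threshold))
  qed
qed

text \<open>The sum grows by \<open>(b - a) * (\<pi> a - \<pi> b)\<close>, as in the rearrangement
  inequality, which makes it a convenient substitute for counting inversions.\<close>

lemma weighted_sum_transpose:
  assumes ab: "a \<in> labels n" "b \<in> labels n" "a < b" and "\<pi> b < \<pi> a"
  shows "(\<Sum>i\<in>labels n. i * \<pi> i) < (\<Sum>i\<in>labels n. i * (\<pi> \<circ> Transposition.transpose a b) i)"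
proof -
  have split: "(\<Sum>i\<in>labels n. h i) = h a + h b + (\<Sum>i\<in>labels n - {a, b}. h i)" for h :: "int \<Rightarrow> int"
    using sum.subset_diff[of "{a, b}" "labels n" h] ab by simp
  have "(\<Sum>i\<in>labels n - {a, b}. i * (\<pi> \<circ> Transposition.transpose a b) i) = (\<Sum>i\<in>labels n - {a, b}. i * \<pi> i)"
    by (rule sum.cong) (auto simp: Transposition.transpose_def)
  moreover have "0 < (b - a) * (\<pi> a - \<pi> b)" using assms by simp
  ultimately show ?thesis
    unfolding split by (simp add: algebra_simps)
qed

text \<open>Among the compatible permutations, take one with the fewest inversions (here: with maximal
  \<open>\<Sum>i \<sqdot> \<pi> i\<close>). A descent that is not an arc of \<open>D\<close> could be swapped, and a non-adjacent arc would be
  crossed by the arc of a descent between its ends.\<close>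

lemma exists_delta_eq: "\<exists>\<pi>. \<pi> permutes labels n \<and> delta n \<pi> = D"
proof -
  define P where "P = {\<pi>. \<pi> permutes labels n \<and> compatible \<pi>}"
  have "finite P" unfolding P_def by (rule finite_subset[OF _ finite_permutations[OF finite_labels[of n]]]) auto
  moreover have "P \<noteq> {}" using exists_compatible by (auto simp: P_def)
  ultimately obtain \<pi> where \<pi>: "\<pi> \<in> P"
    "\<And>\<sigma>. \<sigma> \<in> P \<Longrightarrow> (\<Sum>i\<in>labels n. i * \<sigma> i) \<le> (\<Sum>i\<in>labels n. i * \<pi> i)"
    by (rule obtains_Max_image[where f = "\<lambda>\<sigma>. \<Sum>i\<in>labels n. i * \<sigma> i"]) blast
  have perm: "\<pi> permutes labels n" and comp: "compatible \<pi>" using \<pi>(1) by (auto simp: P_def)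
  have inv[simp]: "inv \<pi> (\<pi> x) = x" "\<pi> (inv \<pi> x) = x" for x using permutes_inverses[OF perm] by auto
  have inl[simp]: "inv \<pi> x \<in> labels n \<longleftrightarrow> x \<in> labels n" "\<pi> x \<in> labels n \<longleftrightarrow> x \<in> labels n" for x
    using perm by (auto simp: permutes_in_image permutes_inv)
  \<comment> \<open>Compatibility places each label between \<open>\<pi> b\<close> and
    \<open>\<pi> a\<close> before \<open>a\<close> or after \<open>b\<close>, so positions alone
    recover the side set, even when \<open>a\<close> and \<open>b\<close> are not
    consecutive.\<close>
  have side: "R = {\<pi> c |c. c \<in> labels n \<and> c < a \<and> \<pi> b < \<pi> c \<and> \<pi> c < \<pi> a}"
    if s: "(\<pi> a, \<pi> b, R) \<in> D" for a b R
  proof -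
    have ab: "a < b" using s comp unfolding compatible_def by (metis inv(1))
    have "x \<in> R \<longleftrightarrow> x \<in> labels n \<and> inv \<pi> x < a \<and> \<pi> b < x \<and> x < \<pi> a" for x
      using s comp ab in_side[OF s, of x] unfolding compatible_def
      by (smt (verit) inv(1))
    moreover have "x \<in> {\<pi> c |c. c \<in> labels n \<and> c < a \<and> \<pi> b < \<pi> c \<and> \<pi> c < \<pi> a} \<longleftrightarrow>
        x \<in> labels n \<and> inv \<pi> x < a \<and> \<pi> b < x \<and> x < \<pi> a" for x
    proof
      assume "x \<in> {\<pi> c |c. c \<in> labels n \<and> c < a \<and> \<pi> b < \<pi> c \<and> \<pi> c < \<pi> a}"
      then show "x \<in> labels n \<and> inv \<pi> x < a \<and> \<pi> b < x \<and> x < \<pi> a" by auto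
    next
      assume "x \<in> labels n \<and> inv \<pi> x < a \<and> \<pi> b < x \<and> x < \<pi> a"
      then show "x \<in> {\<pi> c |c. c \<in> labels n \<and> c < a \<and> \<pi> b < \<pi> c \<and> \<pi> c < \<pi> a}"
        by (intro CollectI exI[of _ "inv \<pi> x"]) auto
    qed
    ultimately show ?thesis by blast
  qed
  have descent: "\<exists>R. (\<pi> a, \<pi> b, R) \<in> D" if ab: "consecutive n a b" "\<pi> b < \<pi> a" for a b
  proof (rule ccontr)
    assume "\<nexists>R. (\<pi> a, \<pi> b, R) \<in> D"
    then have c: "compatible (\<pi> \<circ> Transposition.transpose a b)" using compatible_transpose[OF perm comp ab] by blast
    have ab': "a \<in> labels n" "b \<in> labels n" "a < b" using ab by (auto simp: consecutive_def)
    then have "\<pi> \<circ> Transposition.transpose a b permutes labels n"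
      using perm by (intro permutes_compose permutes_swap_id)
    then have "\<pi> \<circ> Transposition.transpose a b \<in> P" using c by (simp add: P_def)
    then show False using \<pi>(2) weighted_sum_transpose[OF ab' ab(2)] by fastforce
  qed
  have "t \<in> D" if "t \<in> delta n \<pi>" for t
  proof -
    obtain a b where t: "t = (\<pi> a, \<pi> b, {\<pi> c |c. c \<in> labels n \<and> c < a \<and> \<pi> b < \<pi> c \<and> \<pi> c < \<pi> a})"
       "consecutive n a b" "\<pi> b < \<pi> a"
      using \<open>t \<in> delta n \<pi>\<close> unfolding delta_def by auto
    then show ?thesis using descent[OF t(2,3)] side by auto
  qed
  moreover have "(q, p, R) \<in> delta n \<pi>" if s: "(q, p, R) \<in> D" for q p R
  proof -
    define a b where "a = inv \<pi> q" and "b = inv \<pi> p"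
    have qp: "q = \<pi> a" "p = \<pi> b" by (auto simp: a_def b_def)
    have ab: "a \<in> labels n" "b \<in> labels n" using ends_in[OF s] by (auto simp: a_def b_def)
    have less: "a < b" using s comp unfolding compatible_def a_def b_def by blast
    have pq: "p < q" using bottom_less_top[OF s] .
    \<comment> \<open>The entries fall from \<open>q\<close> at \<open>a\<close> to \<open>p\<close>
      at \<open>b\<close>, so some descent in between leaves the level of \<open>q\<close>. It turns
      out to be the step from \<open>a\<close> to \<open>b\<close> itself.\<close>
    obtain i j where ij: "consecutive n i j" "a \<le> i" "j \<le> b" "q \<le> \<pi> i" "\<not> q \<le> \<pi> j"
      using exists_consecutive_step[OF ab less, of "\<lambda>i. q \<le> \<pi> i"] qp pq by (metis not_less order_refl)
    have ij': "i \<in> labels n" "j \<in> labels n" "i < j" using ij by (auto simp: consecutive_def)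
    \<comment> \<open>Compatibility would place a value strictly between \<open>p\<close> and
      \<open>q\<close> before \<open>a\<close> or after \<open>b\<close>.\<close>
    have "\<pi> j \<le> p"
    proof (rule ccontr)
      assume "\<not> \<pi> j \<le> p"
      then have "j < a \<or> b < j"
        using s comp ij ij' unfolding compatible_def a_def b_def
        by (metis inl(2) inv(1) linorder_not_le)
      then show False using ij ij' by auto
    qed
    obtain R' where t: "(\<pi> i, \<pi> j, R') \<in> D" using descent[of i j] ij by auto
    have "i = a \<and> j = b"
    proof (rule ccontr)
      assume ne: "\<not> (i = a \<and> j = b)"
      have "\<pi> i \<noteq> q"
      proof
        assume "\<pi> i = q"
        then have "i = a \<and> \<pi> j = p" using t s top_unique by (auto simp: a_def)
        then show False using ne by (auto simp: b_def)
      qed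
      have "\<pi> j \<noteq> p"
      proof
        assume "\<pi> j = p"
        then have "j = b \<and> \<pi> i = q" using t s bottom_unique by (auto simp: b_def)
        then show False using ne by (auto simp: a_def)
      qed
      have out: "q < \<pi> i" "\<pi> j < p" using ij(4) \<open>\<pi> j \<le> p\<close> \<open>\<pi> i \<noteq> q\<close> \<open>\<pi> j \<noteq> p\<close> by auto
      have "i \<noteq> a" "j \<noteq> b" using out qp by auto
      then have "a < i" "j < b" using ij by auto
      have "q \<in> R'"
        unfolding side[OF t] using \<open>a < i\<close> out pq ab qp by (intro CollectI exI[of _ a]) auto
      moreover have "p \<notin> R'"
      proof
        assume "p \<in> R'"
        then obtain c where "\<pi> b = \<pi> c" "c < i" using side[OF t] qp by auto
        then have "b < i" by (metis inv(1))
        then show False using \<open>j < b\<close> ij'(3) by simp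
      qed
      \<comment> \<open>The longer curve is right of the axis at height \<open>q\<close> and left of
        it at height \<open>p\<close>, while the curve from \<open>q\<close> to \<open>p\<close> is
        on the axis at both heights; so their order would change.\<close>
      ultimately have pos: "F (\<pi> i, \<pi> j, R') (real_of_int q) > 0" "F (\<pi> i, \<pi> j, R') (real_of_int p) < 0"
        using side_iff[OF t] out pq ends_in[OF s] by force+
      have "F (\<pi> i, \<pi> j, R') (real_of_int q) \<le> F (q, p, R) (real_of_int q)"
        by (rule order_preserved[OF t s, where y = "real_of_int p"])
          (use out pq pos bottom_zero[OF s] in auto)
      then show False using pos(1) top_zero[OF s] by simp
    qed
    then have "consecutive n a b" using ij(1) by simp
    then show ?thesis using side[of a b R] s pq qp unfolding delta_def by auto
  qed
  ultimately have "delta n \<pi> = D" by auto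
  then show ?thesis using perm by blast
qed

end

section \<open>Arcs and drawings of a permutation\<close>

lemma consecutive_right_unique: "consecutive n a b \<Longrightarrow> consecutive n a c \<Longrightarrow> b = c"
  unfolding consecutive_def by (metis Int_iff empty_iff greaterThanLessThan_iff linorder_neqE)

lemma consecutive_left_unique: "consecutive n b a \<Longrightarrow> consecutive n c a \<Longrightarrow> b = c"
  unfolding consecutive_def by (metis Int_iff empty_iff greaterThanLessThan_iff linorder_neqE)

lemma labels_uminus [simp]: "- i \<in> labels n \<longleftrightarrow> i \<in> labels n"
  by (auto simp: labels_def)

lemma consecutive_uminus: "consecutive n a b \<Longrightarrow> consecutive n (- b) (- a)"
  unfolding consecutive_def
  by (metis (no_types, lifting) Int_iff equals0D equals0I greaterThanLessThan_iff labels_uminus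
      minus_less_iff neg_less_iff_less less_minus_iff)

lemma deltaE:
  assumes "t \<in> delta n \<pi>"
  obtains a b where "consecutive n a b" "\<pi> b < \<pi> a"
    "t = (\<pi> a, \<pi> b, {\<pi> c |c. c \<in> labels n \<and> c < a \<and> \<pi> b < \<pi> c \<and> \<pi> c < \<pi> a})"
  using assms unfolding delta_def by auto

lemma deltaI:
  "consecutive n a b \<Longrightarrow> \<pi> b < \<pi> a \<Longrightarrow>
    (\<pi> a, \<pi> b, {\<pi> c |c. c \<in> labels n \<and> c < a \<and> \<pi> b < \<pi> c \<and> \<pi> c < \<pi> a}) \<in> delta n \<pi>"
  unfolding delta_def by blast

section \<open>Descent arcs determine the permutation\<close>

lemma delta_top_unique:
  assumes "inj \<pi>" "(q, p, R) \<in> delta n \<pi>" "(q, p', R') \<in> delta n \<pi>"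
  shows "p = p' \<and> R = R'"
proof -
  obtain a b where ab: "consecutive n a b" "(q, p, R) = (\<pi> a, \<pi> b, {\<pi> c |c. c \<in> labels n \<and> c < a \<and> \<pi> b < \<pi> c \<and> \<pi> c < \<pi> a})"
    using assms(2) by (elim deltaE)
  obtain a' b' where ab': "consecutive n a' b'" "(q, p', R') = (\<pi> a', \<pi> b', {\<pi> c |c. c \<in> labels n \<and> c < a' \<and> \<pi> b' < \<pi> c \<and> \<pi> c < \<pi> a'})"
    using assms(3) by (elim deltaE)
  have "a = a'" using ab(2) ab'(2) assms(1) by (simp add: inj_eq)
  then have "b = b'" using ab(1) ab'(1) consecutive_right_unique by blast
  then show ?thesis using ab(2) ab'(2) \<open>a = a'\<close> by simp
qed

lemma delta_bottom_unique:
  assumes "inj \<pi>" "(q, p, R) \<in> delta n \<pi>" "(q', p, R') \<in> delta n \<pi>"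
  shows "q = q' \<and> R = R'"
proof -
  obtain a b where ab: "consecutive n a b" "(q, p, R) = (\<pi> a, \<pi> b, {\<pi> c |c. c \<in> labels n \<and> c < a \<and> \<pi> b < \<pi> c \<and> \<pi> c < \<pi> a})"
    using assms(2) by (elim deltaE)
  obtain a' b' where ab': "consecutive n a' b'" "(q', p, R') = (\<pi> a', \<pi> b', {\<pi> c |c. c \<in> labels n \<and> c < a' \<and> \<pi> b' < \<pi> c \<and> \<pi> c < \<pi> a'})"
    using assms(3) by (elim deltaE)
  have "b = b'" using ab(2) ab'(2) assms(1) by (simp add: inj_eq)
  then have "a = a'" using ab(1) ab'(1) consecutive_left_unique by blast
  then show ?thesis using ab(2) ab'(2) \<open>b = b'\<close> by simp
qed

text \<open>The value \<open>\<pi> a\<close> occurs in \<open>\<sigma>\<close> only later, at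
  \<open>b\<close>, so \<open>\<sigma>\<close> has a descent between \<open>a\<close> and
  \<open>b\<close> falling from above \<open>\<pi> a\<close> to at most \<open>\<pi> a\<close>. Its
  arc ends at \<open>\<pi> a\<close> or passes left of it. As an arc of \<open>\<pi>\<close> it
  would come from a descent starting after \<open>a\<close>, hence could not end at
  \<open>\<pi> a\<close> and would pass right of it.\<close>

lemma delta_unequal_at_first_difference:
  assumes perm: "\<pi> permutes labels n" "\<sigma> permutes labels n" and a: "a \<in> labels n"
    and before: "\<And>c. c \<in> labels n \<Longrightarrow> c < a \<Longrightarrow> \<pi> c = \<sigma> c" and less: "\<pi> a < \<sigma> a"
  shows "delta n \<pi> \<noteq> delta n \<sigma>"
proof
  assume eq: "delta n \<pi> = delta n \<sigma>"
  have inj: "inj \<pi>" "inj \<sigma>" using perm by (auto dest: permutes_inj)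
  define b where "b = inv \<sigma> (\<pi> a)"
  have b: "b \<in> labels n" "\<sigma> b = \<pi> a"
    using perm a permutes_inverses(1)[OF perm(2)] by (auto simp: b_def permutes_in_image permutes_inv)
  have "\<not> b < a"
  proof
    assume "b < a"
    then have "\<pi> b = \<pi> a" using before b by simp
    then show False using inj \<open>b < a\<close> by (simp add: inj_eq)
  qed
  moreover have "b \<noteq> a" using b less by auto
  ultimately have "a < b" by simp
  then obtain i j where ij: "consecutive n i j" "a \<le> i" "j \<le> b" "\<pi> a < \<sigma> i" "\<not> \<pi> a < \<sigma> j"
    using exists_consecutive_step[OF a b(1), of "\<lambda>i. \<pi> a < \<sigma> i"] less b(2) by auto
  have "(\<sigma> i, \<sigma> j, {\<sigma> c |c. c \<in> labels n \<and> c < i \<and> \<sigma> j < \<sigma> c \<and> \<sigma> c < \<sigma> i}) \<in> delta n \<pi>"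
    unfolding eq using ij by (intro deltaI) auto
  then obtain k l where kl: "consecutive n k l" "\<sigma> i = \<pi> k" "\<sigma> j = \<pi> l"
    "{\<sigma> c |c. c \<in> labels n \<and> c < i \<and> \<sigma> j < \<sigma> c \<and> \<sigma> c < \<sigma> i} =
     {\<pi> c |c. c \<in> labels n \<and> c < k \<and> \<pi> l < \<pi> c \<and> \<pi> c < \<pi> k}"
    by (elim deltaE) auto
  have kl': "k \<in> labels n" "k < l" and ij': "i < j" using kl ij by (auto simp: consecutive_def)
  have "\<not> k < a"
  proof
    assume "k < a"
    then have "\<sigma> k = \<sigma> i" using before kl' kl by simp
    then show False using inj \<open>k < a\<close> ij by (simp add: inj_eq)
  qed
  moreover have "k \<noteq> a" using kl ij by auto
  ultimately have ak: "a < k" by simp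
  show False
  proof (cases "\<sigma> j = \<pi> a")
    case True
    then have "l = a" using kl inj by (simp add: inj_eq)
    then show False using ak kl' by simp
  next
    case False
    then have "\<pi> a \<in> {\<pi> c |c. c \<in> labels n \<and> c < k \<and> \<pi> l < \<pi> c \<and> \<pi> c < \<pi> k}"
      using ak kl ij a by auto
    then obtain c where "\<pi> a = \<sigma> c" "c < i" unfolding kl(4)[symmetric] by auto
    then have "b < i" using b(2) inj by (simp add: inj_eq)
    then show False using ij ij' by simp
  qed
qed

lemma delta_inject:
  assumes perm: "\<pi> permutes labels n" "\<sigma> permutes labels n" and eq: "delta n \<pi> = delta n \<sigma>"
  shows "\<pi> = \<sigma>"
proof (rule ccontr)
  assume "\<pi> \<noteq> \<sigma>"
  define B where "B = {c \<in> labels n. \<pi> c \<noteq> \<sigma> c}"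
  have "B \<noteq> {}"
    using \<open>\<pi> \<noteq> \<sigma>\<close> perm by (auto simp: B_def fun_eq_iff) (metis permutes_not_in)
  moreover have "finite B" by (simp add: B_def)
  ultimately have "Min B \<in> B" and least: "\<And>c. c \<in> B \<Longrightarrow> Min B \<le> c" by auto
  then have a: "Min B \<in> labels n" "\<pi> (Min B) \<noteq> \<sigma> (Min B)" by (auto simp: B_def)
  have before: "\<pi> c = \<sigma> c" if "c \<in> labels n" "c < Min B" for c
  proof -
    have "c \<notin> B" using least[of c] that(2) by auto
    then show ?thesis using that(1) unfolding B_def by blast
  qed
  show False
    using delta_unequal_at_first_difference[OF perm a(1) before] a(2) eq
      delta_unequal_at_first_difference[OF perm(2,1) a(1) before[symmetric]]
    by (metis linorder_neqE)
qed

text \<open>The summands are multiples of tent functions that are 1 at \<open>i\<close> and 0 at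
  every other integer, so this interpolates \<open>inv \<pi>\<close> on the labels by a piecewise
  linear function. For signed permutations it is odd, so the shear preserves central
  symmetry.\<close>

definition shear :: "nat \<Rightarrow> (int \<Rightarrow> int) \<Rightarrow> real \<Rightarrow> real" where
  "shear n \<pi> y = (\<Sum>i\<in>labels n. real_of_int (inv \<pi> i) * max 0 (1 - \<bar>y - real_of_int i\<bar>))"

text \<open>The horizontal coordinate of the segment from \<open>(\<pi>\<inverse> q, q)\<close> to \<open>(\<pi>\<inverse> p, p)\<close> after the shear that
  moves all points \<open>(\<pi>\<inverse> i, i)\<close> to the vertical axis.\<close>

definition sheared_segment :: "nat \<Rightarrow> (int \<Rightarrow> int) \<Rightarrow> int \<Rightarrow> int \<Rightarrow> real \<Rightarrow> real" where
  "sheared_segment n \<pi> q p y = real_of_int (inv \<pi> q) +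
     real_of_int (inv \<pi> p - inv \<pi> q) * ((real_of_int q - y) / real_of_int (q - p)) - shear n \<pi> y"

lemma shear_label: "k \<in> labels n \<Longrightarrow> shear n \<pi> (real_of_int k) = real_of_int (inv \<pi> k)"
proof -
  assume k: "k \<in> labels n"
  have "max 0 (1 - \<bar>real_of_int k - real_of_int i\<bar>) = (if i = k then 1 else 0)" for i
  proof (cases "i = k")
    case False
    then have "1 \<le> \<bar>k - i\<bar>" by simp
    then have "1 \<le> \<bar>real_of_int k - real_of_int i\<bar>" by (metis of_int_1_le_iff of_int_abs of_int_diff)
    then show ?thesis using False by simp
  qed simp
  then have "shear n \<pi> (real_of_int k) = (\<Sum>i\<in>labels n. if i = k then real_of_int (inv \<pi> i) else 0)"
    unfolding shear_def by (intro sum.cong) auto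
  then show ?thesis using k by simp
qed

lemma signed_permsD:
  assumes "\<pi> \<in> signed_perms n"
  shows "\<pi> permutes labels n" "\<pi> (- i) = - \<pi> i" "inv \<pi> (- i) = - inv \<pi> i"
proof -
  show perm: "\<pi> permutes labels n" and odd: "\<pi> (- i) = - \<pi> i" for i
    using assms by (auto simp: signed_perms_def)
  show "inv \<pi> (- i) = - inv \<pi> i"
    using permutes_inverses[OF perm] odd by (metis minus_minus)
qed

lemma shear_uminus:
  assumes "\<pi> \<in> signed_perms n"
  shows "shear n \<pi> (- y) = - shear n \<pi> y"
proof -
  have abs: "\<bar>- y - x\<bar> = \<bar>y + x\<bar>" for x by arith
  have "shear n \<pi> (- y) = (\<Sum>i\<in>labels n. - (real_of_int (inv \<pi> i) * max 0 (1 - \<bar>y - real_of_int i\<bar>)))"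
    unfolding shear_def
    by (rule sum.reindex_bij_witness[of _ uminus uminus])
      (simp_all add: signed_permsD(3)[OF assms] abs)
  then show ?thesis by (simp add: shear_def sum_negf)
qed

lemma continuous_on_shear [continuous_intros]: "continuous_on A (shear n \<pi>)"
  unfolding shear_def by (intro continuous_intros)

lemma image_uminus_curve: "uminus ` curve f q p = curve (\<lambda>y. - f (- y)) (- p) (- q)"
proof
  show "uminus ` curve f q p \<subseteq> curve (\<lambda>y. - f (- y)) (- p) (- q)"
  proof
    fix x assume "x \<in> uminus ` curve f q p"
    then obtain y where "x = (- f y, - y)" "real_of_int p \<le> y" "y \<le> real_of_int q"
      by (auto simp: curve_def)
    then show "x \<in> curve (\<lambda>y. - f (- y)) (- p) (- q)"
      unfolding curve_def by (intro CollectI exI[of _ "- y"]) auto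
  qed
  show "curve (\<lambda>y. - f (- y)) (- p) (- q) \<subseteq> uminus ` curve f q p"
  proof
    fix x assume "x \<in> curve (\<lambda>y. - f (- y)) (- p) (- q)"
    then obtain y where "x = - (f (- y), - y)" "real_of_int p \<le> - y" "- y \<le> real_of_int q"
      by (auto simp: curve_def)
    then show "x \<in> uminus ` curve f q p" unfolding curve_def by blast
  qed
qed

lemma in_curve_iff: "(x, y) \<in> curve f q p \<longleftrightarrow> real_of_int p \<le> y \<and> y \<le> real_of_int q \<and> x = f y"
  by (auto simp: curve_def)

lemma curve_cong:
  "(\<And>y. real_of_int p \<le> y \<Longrightarrow> y \<le> real_of_int q \<Longrightarrow> f y = g y) \<Longrightarrow> curve f q p = curve g q p"
  unfolding set_eq_iff by (auto simp: curve_def)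

text \<open>The equality cases confine a common point of two segments in adjoining strips to their
  ends.\<close>

lemma affine_between:
  fixes a b q p y :: real
  assumes "a < b" "p < q" "p \<le> y" "y \<le> q"
  defines "v \<equiv> a + (b - a) * ((q - y) / (q - p))"
  shows "a \<le> v" "v \<le> b" "v = a \<Longrightarrow> y = q" "v = b \<Longrightarrow> y = p"
proof -
  define l where "l = (q - y) / (q - p)"
  have l: "0 \<le> l" "l \<le> 1" "l = 0 \<longleftrightarrow> y = q" "l = 1 \<longleftrightarrow> y = p"
    using assms(1-4) by (auto simp: l_def)
  have v: "v = a + (b - a) * l" by (simp add: v_def l_def)
  show "a \<le> v" using v l assms(1) by simp
  have "b - v = (b - a) * (1 - l)" by (simp add: v algebra_simps)
  moreover from this have "0 \<le> b - v" using l assms(1) by simp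
  ultimately show "v \<le> b" "v = b \<Longrightarrow> y = p" using l(4) assms(1) by simp_all
  show "v = a \<Longrightarrow> y = q" using v l assms(1) by auto
qed

text \<open>Before the shear the segment lies in the strip between the consecutive positions
  \<open>a\<close> and \<open>b\<close>. Every other plot point is left of that strip, if its
  position precedes \<open>a\<close>, or right of it, and the shear preserves the order at each
  height.\<close>

lemma drawn_sym_sheared_segment:
  assumes "\<pi> \<in> signed_perms n" "(q, p, R) \<in> delta n \<pi>"
  shows "drawn_sym n (q, p, R) (curve (sheared_segment n \<pi> q p) q p)"
proof -
  note perm = signed_permsD(1)[OF assms(1)]
  obtain a b where ab: "consecutive n a b" "\<pi> b < \<pi> a" and
    q: "q = \<pi> a" and p: "p = \<pi> b" and R: "R = {\<pi> c |c. c \<in> labels n \<and> c < a \<and> \<pi> b < \<pi> c \<and> \<pi> c < \<pi> a}"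
    using assms(2) by (elim deltaE) auto
  have inv: "inv \<pi> (\<pi> x) = x" for x using permutes_inverses[OF perm] by auto
  have inl: "\<pi> x \<in> labels n \<longleftrightarrow> x \<in> labels n" for x using perm by (simp add: permutes_in_image)
  have ab': "a \<in> labels n" "b \<in> labels n" "a < b" "\<And>c. c \<in> labels n \<Longrightarrow> c \<le> a \<or> b \<le> c"
    using ab by (force simp: consecutive_def)+
  have qp: "q \<in> labels n" "p \<in> labels n" "p < q" using ab' ab q p inl by auto
  have at_label: "sheared_segment n \<pi> q p (real_of_int (\<pi> c)) =
    real_of_int a + (real_of_int b - real_of_int a) * ((real_of_int q - real_of_int (\<pi> c)) / (real_of_int q - real_of_int p)) - real_of_int c"
    if "c \<in> labels n" for c
    using that inl by (simp add: sheared_segment_def shear_label inv q p)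
  have side: "if \<pi> c \<in> R then sheared_segment n \<pi> q p (real_of_int (\<pi> c)) > 0
      else sheared_segment n \<pi> q p (real_of_int (\<pi> c)) < 0"
    if c: "c \<in> labels n" "p < \<pi> c" "\<pi> c < q" for c
  proof -
    have ne: "c \<noteq> a" "c \<noteq> b" using c q p by auto
    have "real_of_int a \<le> sheared_segment n \<pi> q p (real_of_int (\<pi> c)) + real_of_int c"
      "sheared_segment n \<pi> q p (real_of_int (\<pi> c)) + real_of_int c \<le> real_of_int b"
      using affine_between(1,2)[of "real_of_int a" "real_of_int b" "real_of_int p" "real_of_int q" "real_of_int (\<pi> c)"]
        at_label[OF c(1)] ab'(3) qp(3) c by simp_all
    note btw = this
    show ?thesis
    proof (cases "c < a")
      case True
      then have "\<pi> c \<in> R" using R c q p by blast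
      moreover have "real_of_int c < real_of_int a" using True by simp
      ultimately show ?thesis using btw by simp
    next
      case False
      then have "b < c" using ab'(4)[OF c(1)] ne by auto
      have "\<pi> c \<notin> R"
      proof
        assume "\<pi> c \<in> R"
        then obtain c' where "\<pi> c = \<pi> c'" "c' < a" using R by auto
        then show False using False inv by metis
      qed
      moreover have "real_of_int b < real_of_int c" using \<open>b < c\<close> by simp
      ultimately show ?thesis using btw by simp
    qed
  qed
  have "descends (labels n) q p R (sheared_segment n \<pi> q p)"
    unfolding descends_def
  proof (intro conjI ballI)
    show "p < q" by fact
    show "continuous_on {real_of_int p..real_of_int q} (sheared_segment n \<pi> q p)"
      unfolding sheared_segment_def using qp(3) by (intro continuous_intros) auto
    show "sheared_segment n \<pi> q p (real_of_int q) = 0" using at_label[OF ab'(1)] q by simp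
    show "R \<subseteq> labels n \<inter> {p<..<q}" using R q p inl by auto
    fix i assume i: "i \<in> labels n \<inter> {p<..<q}"
    obtain c where "i = \<pi> c" using permutes_inverses(1)[OF perm] by metis
    then show "if i \<in> R then sheared_segment n \<pi> q p (real_of_int i) > 0
        else sheared_segment n \<pi> q p (real_of_int i) < 0"
      using side[of c] i inl[of c] by simp
  qed
  moreover have "sheared_segment n \<pi> q p (real_of_int p) = 0" using at_label[OF ab'(2)] p qp(3) by simp
  ultimately show ?thesis using qp by auto
qed

lemma exists_symmetric_drawing:
  assumes \<pi>: "\<pi> \<in> signed_perms n"
  shows "\<exists>C. symmetric_drawing n (delta n \<pi>) C"
proof -
  note perm = signed_permsD(1)[OF \<pi>]
  have inv: "inv \<pi> (\<pi> x) = x" for x using permutes_inverses[OF perm] by auto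
  define C :: "sym_arc \<Rightarrow> plane set" where
    "C = (\<lambda>(q, p, R). curve (sheared_segment n \<pi> q p) q p)"
  have "uminus ` C t \<in> C ` delta n \<pi>" if t: "t \<in> delta n \<pi>" for t
  proof -
    obtain a b where ab: "consecutive n a b" "\<pi> b < \<pi> a" and
      t': "t = (\<pi> a, \<pi> b, {\<pi> c |c. c \<in> labels n \<and> c < a \<and> \<pi> b < \<pi> c \<and> \<pi> c < \<pi> a})"
      using t by (elim deltaE)
    let ?s = "(\<pi> (- b), \<pi> (- a), {\<pi> c |c. c \<in> labels n \<and> c < - b \<and> \<pi> (- a) < \<pi> c \<and> \<pi> c < \<pi> (- b)})"
    have s: "?s \<in> delta n \<pi>"
      using ab by (intro deltaI consecutive_uminus) (auto simp: signed_permsD(2)[OF \<pi>])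
    have "uminus ` C t = curve (\<lambda>y. - sheared_segment n \<pi> (\<pi> a) (\<pi> b) (- y)) (- \<pi> b) (- \<pi> a)"
      by (simp add: C_def t' image_uminus_curve)
    also have "\<dots> = curve (sheared_segment n \<pi> (- \<pi> b) (- \<pi> a)) (- \<pi> b) (- \<pi> a)"
    proof (rule curve_cong)
      fix y
      define d where "d = real_of_int (\<pi> a) - real_of_int (\<pi> b)"
      have "d > 0" using ab by (simp add: d_def)
      \<comment> \<open>The half-turned segment is parametrized from its other end; the two
        expressions agree once the denominator \<open>d\<close> is cleared.\<close>
      then show "- sheared_segment n \<pi> (\<pi> a) (\<pi> b) (- y) = sheared_segment n \<pi> (- \<pi> b) (- \<pi> a) y"
        by (simp add: sheared_segment_def shear_uminus[OF \<pi>] signed_permsD(3)[OF \<pi>] inv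
            flip: d_def) (simp add: field_simps, simp add: d_def algebra_simps)
    qed
    also have "\<dots> = C ?s" by (simp add: C_def signed_permsD(2)[OF \<pi>])
    finally show ?thesis using s by blast
  qed
  moreover have "C s \<inter> C t \<subseteq> (\<lambda>i. (0, real_of_int i)) ` (ends_sym s \<inter> ends_sym t)"
    if s: "s \<in> delta n \<pi>" and t: "t \<in> delta n \<pi>" and ne: "s \<noteq> t" for s t
  proof -
    \<comment> \<open>Distinct descents occupy strips without common interior. The shear moves both
      segments equally at each height, so a common point forces \<open>v = w\<close>, and the strips
      touch there.\<close>
    have *: "(f, y) \<in> (\<lambda>i. (0, real_of_int i)) ` (ends_sym s \<inter> ends_sym t)"
      if s: "consecutive n a b" "\<pi> b < \<pi> a" "s = (\<pi> a, \<pi> b, R)" "s \<in> delta n \<pi>"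
        and t: "consecutive n a' b'" "\<pi> b' < \<pi> a'" "t = (\<pi> a', \<pi> b', R')"
        and aa: "a < a'" and y: "(f, y) \<in> C s" "(f, y) \<in> C t" for a b R s a' b' R' t f y
    proof -
      have ab: "a < b" "a' < b'" "b \<le> a'"
        using s t aa unfolding consecutive_def by (auto simp: disjoint_iff not_less)
      define v where "v = real_of_int a + (real_of_int b - real_of_int a) *
        ((real_of_int (\<pi> a) - y) / (real_of_int (\<pi> a) - real_of_int (\<pi> b)))"
      define w where "w = real_of_int a' + (real_of_int b' - real_of_int a') *
        ((real_of_int (\<pi> a') - y) / (real_of_int (\<pi> a') - real_of_int (\<pi> b')))"
      have ys: "real_of_int (\<pi> b) \<le> y" "y \<le> real_of_int (\<pi> a)" "f = v - shear n \<pi> y"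
        using y s by (auto simp: C_def in_curve_iff sheared_segment_def v_def inv)
      have yt: "real_of_int (\<pi> b') \<le> y" "y \<le> real_of_int (\<pi> a')" "f = w - shear n \<pi> y"
        using y t by (auto simp: C_def in_curve_iff sheared_segment_def w_def inv)
      have "v \<le> real_of_int b" "v = real_of_int b \<Longrightarrow> y = real_of_int (\<pi> b)"
        using affine_between(2,4)[of "real_of_int a" "real_of_int b" "real_of_int (\<pi> b)" "real_of_int (\<pi> a)" y]
          ys s ab by (auto simp: v_def)
      moreover have "real_of_int a' \<le> w" "w = real_of_int a' \<Longrightarrow> y = real_of_int (\<pi> a')"
        using affine_between(1,3)[of "real_of_int a'" "real_of_int b'" "real_of_int (\<pi> b')" "real_of_int (\<pi> a')" y]
          yt t ab by (auto simp: w_def)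
      moreover have "v = w" "real_of_int b \<le> real_of_int a'" using ys yt ab by auto
      ultimately have "y = real_of_int (\<pi> b)" "y = real_of_int (\<pi> a')" "v = real_of_int b" by linarith+
      moreover from this have "f = 0"
        using ys(3) s(1) perm by (simp add: shear_label inv consecutive_def permutes_in_image)
      ultimately show ?thesis using s t by auto
    qed
    obtain a b where ab: "consecutive n a b" "\<pi> b < \<pi> a" and
      s': "s = (\<pi> a, \<pi> b, {\<pi> c |c. c \<in> labels n \<and> c < a \<and> \<pi> b < \<pi> c \<and> \<pi> c < \<pi> a})"
      using s by (elim deltaE)
    obtain a' b' where ab': "consecutive n a' b'" "\<pi> b' < \<pi> a'" and
      t': "t = (\<pi> a', \<pi> b', {\<pi> c |c. c \<in> labels n \<and> c < a' \<and> \<pi> b' < \<pi> c \<and> \<pi> c < \<pi> a'})"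
      using t by (elim deltaE)
    have "a \<noteq> a'"
      using ne s' t' ab(1) ab'(1) consecutive_right_unique by blast
    then consider "a < a'" | "a' < a" by linarith
    then show ?thesis
    proof cases
      case 1
      then show ?thesis using *[OF ab s' s ab' t'] by auto
    next
      case 2
      then show ?thesis using *[OF ab' t' t ab s'] by (auto simp: Int_commute)
    qed
  qed
  ultimately show ?thesis
    unfolding symmetric_drawing_def
    using drawn_sym_sheared_segment[OF \<pi>] by (intro exI[of _ C]) (auto simp: C_def image_iff)
qed

section \<open>Curves and the half-turn\<close>

text \<open>The half-turn exchanges left and right, so the new side set is a complement, taken
  within the labels; hence the parameter \<open>n\<close>.\<close>

fun neg_arc :: "nat \<Rightarrow> sym_arc \<Rightarrow> sym_arc" where
  "neg_arc n (q, p, R) = (- p, - q, {c \<in> labels n. - q < c \<and> c < - p \<and> - c \<notin> R})"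

lemma drawn_symE:
  assumes "drawn_sym n (q, p, R) C"
  obtains f where "q \<in> labels n" "p \<in> labels n" "p < q" "descends (labels n) q p R f"
    "continuous_on {real_of_int p..real_of_int q} f"
    "f (real_of_int q) = 0" "f (real_of_int p) = 0" "C = curve f q p"
    "R = {c \<in> labels n. p < c \<and> c < q \<and> 0 < f (real_of_int c)}"
    "\<And>c. c \<in> labels n \<Longrightarrow> p < c \<Longrightarrow> c < q \<Longrightarrow> f (real_of_int c) \<noteq> 0"
proof -
  obtain f where f: "q \<in> labels n" "p \<in> labels n" "descends (labels n) q p R f" "f (real_of_int p) = 0"
    "C = curve f q p"
    using assms by auto
  have side: "if c \<in> R then f (real_of_int c) > 0 else f (real_of_int c) < 0"
    if "c \<in> labels n" "p < c" "c < q" for c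
    using f(3) that by (auto simp: descends_def)
  have sub: "R \<subseteq> labels n \<inter> {p<..<q}" using f(3) by (simp add: descends_def)
  have "c \<in> R \<longleftrightarrow> c \<in> labels n \<and> p < c \<and> c < q \<and> 0 < f (real_of_int c)" for c
    using side[of c] subsetD[OF sub, of c] by (cases "c \<in> R") auto
  then have "R = {c \<in> labels n. p < c \<and> c < q \<and> 0 < f (real_of_int c)}" by blast
  moreover have "f (real_of_int c) \<noteq> 0" if "c \<in> labels n" "p < c" "c < q" for c
    using side[OF that] by (auto split: if_splits)
  ultimately show thesis using that f by (auto simp: descends_def)
qed

lemma snd_image_curve: "snd ` curve f q p = {real_of_int p..real_of_int q}"
  by (force simp: curve_def)

text \<open>The heights covered by the curve give the endpoints, and the sign of its coordinate at
  each label in between gives the side set.\<close>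

lemma drawn_sym_unique:
  assumes "drawn_sym n s C" "drawn_sym n t C"
  shows "s = t"
proof -
  obtain q p R q' p' R' where st: "s = (q, p, R)" "t = (q', p', R')" by (metis prod_cases3)
  obtain f where f: "p < q" "C = curve f q p"
    "R = {c \<in> labels n. p < c \<and> c < q \<and> 0 < f (real_of_int c)}"
    using assms(1) unfolding st by (rule drawn_symE) blast
  obtain g where g: "p' < q'" "C = curve g q' p'"
    "R' = {c \<in> labels n. p' < c \<and> c < q' \<and> 0 < g (real_of_int c)}"
    using assms(2) unfolding st by (rule drawn_symE) blast
  have "{real_of_int p..real_of_int q} = {real_of_int p'..real_of_int q'}"
    using f(2) g(2) by (metis snd_image_curve)
  then have qp: "q = q'" "p = p'" using f(1) g(1) by (auto simp: Icc_eq_Icc)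
  have "f y = g y" if "real_of_int p \<le> y" "y \<le> real_of_int q" for y
    using f(2) g(2) that in_curve_iff by metis
  then have "R = R'" using f(3) g(3) qp by auto
  then show ?thesis using st qp by simp
qed

lemma continuous_on_half_turn:
  fixes f :: "real \<Rightarrow> real"
  assumes "continuous_on {a..b} f"
  shows "continuous_on {- b..- a} (\<lambda>y. - f (- y))"
proof -
  have "continuous_on {- b..- a} (f \<circ> uminus)"
    by (rule continuous_on_compose) (auto intro!: continuous_intros continuous_on_subset[OF assms])
  then show ?thesis by (auto intro: continuous_on_minus simp: o_def)
qed

lemma drawn_sym_uminus:
  assumes "drawn_sym n t C"
  shows "drawn_sym n (neg_arc n t) (uminus ` C)"
proof -
  obtain q p R where t: "t = (q, p, R)" by (metis prod_cases3)
  obtain f where f: "q \<in> labels n" "p \<in> labels n" "p < q"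
    "continuous_on {real_of_int p..real_of_int q} f"
    "f (real_of_int q) = 0" "f (real_of_int p) = 0" "C = curve f q p"
    "R = {c \<in> labels n. p < c \<and> c < q \<and> 0 < f (real_of_int c)}"
    "\<And>c. c \<in> labels n \<Longrightarrow> p < c \<Longrightarrow> c < q \<Longrightarrow> f (real_of_int c) \<noteq> 0"
    using assms unfolding t by (rule drawn_symE) blast
  let ?g = "\<lambda>y. - f (- y)"
  have "continuous_on {real_of_int (- q)..real_of_int (- p)} ?g"
    using continuous_on_half_turn[OF f(4)] by simp
  moreover have "if i \<in> {c \<in> labels n. - q < c \<and> c < - p \<and> - c \<notin> R} then ?g (real_of_int i) > 0
      else ?g (real_of_int i) < 0" if i: "i \<in> labels n \<inter> {- q<..<- p}" for i
    using f(8) f(9)[of "- i"] i by auto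
  ultimately have "descends (labels n) (- p) (- q) {c \<in> labels n. - q < c \<and> c < - p \<and> - c \<notin> R} ?g"
    unfolding descends_def
  proof (intro conjI ballI)
    show "- q < - p" "- f (- real_of_int (- p)) = 0" using f(3,6) by simp_all
    show "{c \<in> labels n. - q < c \<and> c < - p \<and> - c \<notin> R} \<subseteq> labels n \<inter> {- q<..<- p}" by auto
  qed blast+
  then show ?thesis
    unfolding t using f(1,2,5,7) by (auto simp: image_uminus_curve intro!: exI[of _ ?g])
qed

lemma neg_arc_neg_arc:
  assumes "R \<subseteq> labels n \<inter> {p<..<q}"
  shows "neg_arc n (neg_arc n (q, p, R)) = (q, p, R)"
  using assms by auto

lemma label_on_drawn_sym:
  assumes "drawn_sym n t C" "(0, real_of_int i) \<in> C" "i \<in> labels n"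
  shows "i \<in> ends_sym t"
proof -
  obtain q p R where t: "t = (q, p, R)" by (metis prod_cases3)
  obtain f where f: "C = curve f q p"
    "\<And>c. c \<in> labels n \<Longrightarrow> p < c \<Longrightarrow> c < q \<Longrightarrow> f (real_of_int c) \<noteq> 0"
    using assms(1) unfolding t by (rule drawn_symE) blast
  have "p \<le> i" "i \<le> q" "f (real_of_int i) = 0" using assms(2) f(1) by (auto simp: in_curve_iff)
  then have "i = p \<or> i = q" using f(2)[OF assms(3)] by linarith
  then show ?thesis using t by auto
qed

section \<open>Recovering a curve from its image in the orbifold plane\<close>

lemma compact_connected_drawn_sym:
  assumes "drawn_sym n t C"
  shows "compact C" "connected C" "C \<noteq> {}"
proof -
  obtain q p R where t: "t = (q, p, R)" by (metis prod_cases3)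
  obtain f where f: "p < q" "continuous_on {real_of_int p..real_of_int q} f" "C = curve f q p"
    using assms(1) unfolding t by (rule drawn_symE) blast
  have C: "C = (\<lambda>y. (f y, y)) ` {real_of_int p..real_of_int q}"
    unfolding f(3) by (auto simp: curve_def)
  have "continuous_on {real_of_int p..real_of_int q} (\<lambda>y. (f y, y))"
    using f(2) by (intro continuous_intros)
  then show "compact C" "connected C" unfolding C
    by (auto intro: compact_continuous_image connected_continuous_image)
  show "C \<noteq> {}" using f(1) by (auto simp: C)
qed

text \<open>Excludes curves that cross a different half-turned copy of themselves. Such a curve
  could be rerouted along its copy between two opposite crossings without changing its image under
  \<open>phi\<close>.\<close>

definition symmetric_or_disjoint :: "plane set \<Rightarrow> bool" where
  "symmetric_or_disjoint C \<longleftrightarrow> uminus ` C = C \<or> uminus ` C \<inter> C = {}"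

lemma uminus_image_uminus_image [simp]: "uminus ` uminus ` C = (C :: plane set)"
  by (simp add: image_image)

lemma connected_subset_half:
  assumes "connected C" "compact K" "C \<subseteq> K \<union> uminus ` K" "uminus ` K \<inter> K = {}"
  shows "C \<subseteq> K \<or> C \<subseteq> uminus ` (K :: plane set)"
proof -
  have "closed K" "closed (uminus ` K)"
    using assms(2) by (auto intro: compact_imp_closed compact_negations)
  then have "K \<inter> C = {} \<or> uminus ` K \<inter> C = {}"
    using assms by (intro connected_closedD) auto
  then show ?thesis using assms(3) by blast
qed

text \<open>Connectedness puts each set inside the other or inside its half-turn. If the two
  inclusions point to different halves, the smaller set meets its own half-turn, hence is symmetric,
  and equality follows again.\<close>

lemma half_turn_lift_unique:
  assumes C: "compact C" "connected C" "C \<noteq> {}" "symmetric_or_disjoint C"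
    and K: "compact K" "connected K" "K \<noteq> {}" "symmetric_or_disjoint K"
    and eq: "C \<union> uminus ` C = K \<union> uminus ` K"
  shows "C = K \<or> C = uminus ` K"
proof -
  have one: "X \<subseteq> Y \<or> X \<subseteq> uminus ` Y"
    if "connected X" "compact Y" "symmetric_or_disjoint Y" "X \<union> uminus ` X = Y \<union> uminus ` Y" for X Y :: "plane set"
    using connected_subset_half[of X Y] that by (auto simp: symmetric_or_disjoint_def)
  have neg: "X \<subseteq> uminus ` Y \<Longrightarrow> uminus ` X \<subseteq> Y" for X Y :: "plane set"
    using image_mono[of X "uminus ` Y" uminus] by simp
  have disj: "X = Y" if XY: "X \<subseteq> Y" "Y \<subseteq> uminus ` X" "symmetric_or_disjoint X" "X \<noteq> {}" for X Y :: "plane set"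
  proof -
    have "uminus ` X \<inter> X \<noteq> {}" using XY by blast
    then have "uminus ` X = X" using XY(3) by (auto simp: symmetric_or_disjoint_def)
    then show ?thesis using XY by auto
  qed
  from one[OF C(2) K(1,4) eq] show ?thesis
  proof
    assume CK: "C \<subseteq> K"
    from one[OF K(2) C(1,4) eq[symmetric]] show ?thesis
      using CK disj[OF CK _ C(4,3)] by auto
  next
    assume CK: "C \<subseteq> uminus ` K"
    from one[OF K(2) C(1,4) eq[symmetric]] show ?thesis
    proof
      assume "K \<subseteq> C"
      then show ?thesis using disj[of K C] CK K(3,4) by auto
    next
      assume "K \<subseteq> uminus ` C"
      then show ?thesis using CK neg by blast
    qed
  qed
qed

lemma phi_eq_iff: "phi x = phi y \<longleftrightarrow> x = y \<or> x = - y"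
  by (cases x; cases y) (auto split: if_splits simp: abs_eq_iff)

lemma phi_image_eq_iff: "phi ` C = phi ` K \<longleftrightarrow> C \<union> uminus ` C = K \<union> uminus ` K"
proof
  assume eq: "phi ` C = phi ` K"
  have "X \<union> uminus ` X \<subseteq> Y \<union> uminus ` Y" if "phi ` X \<subseteq> phi ` Y" for X Y
  proof
    fix x assume "x \<in> X \<union> uminus ` X"
    then have "phi x \<in> phi ` X" by (metis Un_iff image_iff phi_eq_iff)
    then have "phi x \<in> phi ` Y" using that by blast
    then obtain y where "y \<in> Y" "phi x = phi y" by blast
    then have "x = y \<or> x = - y" by (simp only: phi_eq_iff)
    then show "x \<in> Y \<union> uminus ` Y" using \<open>y \<in> Y\<close> by auto
  qed
  then show "C \<union> uminus ` C = K \<union> uminus ` K" using eq by (metis subset_antisym order_refl)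
next
  assume eq: "C \<union> uminus ` C = K \<union> uminus ` K"
  have "phi ` (X \<union> uminus ` X) = phi ` X" for X
  proof -
    have "phi (- x) = phi x" for x by (simp add: phi_eq_iff)
    then show ?thesis by (simp add: image_Un image_image)
  qed
  then show "phi ` C = phi ` K" using eq by metis
qed

lemma phi_image_uminus [simp]: "phi ` uminus ` C = phi ` C"
  by (auto simp: phi_image_eq_iff)

section \<open>Lifting type-B arcs\<close>

text \<open>The arc whose part above the origin descends from \<open>p\<close> with \<open>S\<close> on its left, and whose half-turned
  part below the origin descends from \<open>q\<close> with \<open>R\<close> on its left.\<close>

definition joined_arc :: "int \<Rightarrow> int set \<Rightarrow> int \<Rightarrow> int set \<Rightarrow> sym_arc" where
  "joined_arc p S q R = (p, - q, S \<union> {c. - q < c \<and> c < 0 \<and> - c \<notin> R})"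

text \<open>One of the at most two lifts is singled out: the copy above the origin for an ordinary
  arc, the copy containing the left piece for a long arc. The half-turn carries the right end of the
  semicircle to its left end, where the two pieces join.\<close>

fun base_lift :: "typeB_arc \<Rightarrow> sym_arc" where
  "base_lift (Ordinary q p R) = (q, p, R)"
| "base_lift (Orbifold p R) = joined_arc p R p R"
| "base_lift (Long p S q R) = joined_arc p S q R"

definition lifts :: "nat \<Rightarrow> typeB_arc \<Rightarrow> sym_arc set" where
  "lifts n T = {base_lift T, neg_arc n (base_lift T)}"

lemma in_labels_iff: "i \<in> labels n \<longleftrightarrow> i \<noteq> 0 \<and> \<bar>i\<bar> \<le> int n"
  by (auto simp: labels_def)

lemma neg_arc_joined_arc:
  assumes S: "S \<subseteq> {1..<p}" and R: "R \<subseteq> {1..<q}" and pq: "p \<in> {1..int n}" "q \<in> {1..int n}"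
  shows "neg_arc n (joined_arc p S q R) = joined_arc q R p S"
proof -
  have "c \<in> labels n \<and> - p < c \<and> c < q \<and> - c \<notin> S \<union> {c. - q < c \<and> c < 0 \<and> - c \<notin> R} \<longleftrightarrow>
      c \<in> R \<union> {c. - p < c \<and> c < 0 \<and> - c \<notin> S}" for c
    using subsetD[OF S, of "- c"] subsetD[OF R, of c] pq
    by (cases "0 < c") (auto simp: in_labels_iff)
  then show ?thesis unfolding joined_arc_def neg_arc.simps by auto
qed

lemma joined_arc_inject:
  assumes S: "S \<subseteq> {1..<p}" "S' \<subseteq> {1..<p'}" and R: "R \<subseteq> {1..<q}" "R' \<subseteq> {1..<q'}"
    and eq: "joined_arc p S q R = joined_arc p' S' q' R'"
  shows "p = p' \<and> S = S' \<and> q = q' \<and> R = R'"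
proof -
  have pq: "p = p'" "q = q'"
    and sets: "c \<in> S \<or> - q < c \<and> c < 0 \<and> - c \<notin> R \<longleftrightarrow> c \<in> S' \<or> - q < c \<and> c < 0 \<and> - c \<notin> R'" for c
    using eq by (auto simp: joined_arc_def)
  have "c \<in> S \<longleftrightarrow> c \<in> S'" for c
    using sets[of c] subsetD[OF S(1), of c] subsetD[OF S(2), of c] by auto
  moreover have "c \<in> R \<longleftrightarrow> c \<in> R'" for c
    using sets[of "- c"] subsetD[OF R(1), of c] subsetD[OF R(2), of c]
      subsetD[OF S(1), of "- c"] subsetD[OF S(2), of "- c"] pq by auto
  ultimately show ?thesis using pq by auto
qed

text \<open>At height 0 the left piece is left of the right piece, and disjointness preserves this
  at all common heights, in particular at the lower of the two tops. This tells a long arc from the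
  label with its pieces exchanged.\<close>

lemma drawn_Long_sides:
  assumes "drawn n (Long p S q R) A"
  shows "p < q \<longrightarrow> p \<in> R" "q < p \<longrightarrow> q \<notin> S"
proof -
  obtain f g where fg: "p \<in> {1..int n}" "q \<in> {1..int n}"
    "descends {1..int n} p 0 S f" "descends {1..int n} q 0 R g" "f 0 < g 0"
    "curve f p 0 \<inter> curve g q 0 = {}"
    using assms by fastforce
  have less: "f y < g y" if y: "0 \<le> y" "y \<le> real_of_int (min p q)" for y
  proof (rule ccontr)
    assume not_less: "\<not> f y < g y"
    have "continuous_on {0..real_of_int p} f" "continuous_on {0..real_of_int q} g"
      using fg by (auto simp: descends_def)
    then have "continuous_on {0..y} (\<lambda>y. f y - g y)"
      using y by (intro continuous_intros) (auto elim!: continuous_on_subset)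
    then obtain z where "0 \<le> z" "z \<le> y" "f z - g z = 0"
      using IVT'[of "\<lambda>y. f y - g y" 0 0 y] fg(5) not_less y by force
    then have "(f z, z) \<in> curve f p 0 \<inter> curve g q 0" using y by (auto simp: in_curve_iff)
    then show False using fg(6) by simp
  qed
  have zero: "f (real_of_int p) = 0" "g (real_of_int q) = 0" using fg(3,4) by (auto simp: descends_def)
  show "p < q \<longrightarrow> p \<in> R"
  proof
    assume "p < q"
    then have "if p \<in> R then g (real_of_int p) > 0 else g (real_of_int p) < 0"
      using fg(1,4) by (auto simp: descends_def)
    moreover have "0 < g (real_of_int p)" using less[of "real_of_int p"] \<open>p < q\<close> fg(1) zero by simp
    ultimately show "p \<in> R" by (auto split: if_splits)
  qed
  show "q < p \<longrightarrow> q \<notin> S"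
  proof
    assume "q < p"
    then have "if q \<in> S then f (real_of_int q) > 0 else f (real_of_int q) < 0"
      using fg(2,3) by (auto simp: descends_def)
    moreover have "f (real_of_int q) < 0" using less[of "real_of_int q"] \<open>q < p\<close> fg(2) zero by simp
    ultimately show "q \<notin> S" by (auto split: if_splits)
  qed
qed

lemma descends_bounds: "descends M q p R f \<Longrightarrow> p < q \<and> R \<subseteq> M \<inter> {p<..<q}"
  by (simp add: descends_def)

lemma descends_positive: "descends {1..int n} p 0 R f \<Longrightarrow> R \<subseteq> {1..<p}"
  by (drule descends_bounds) auto

lemma drawn_Ordinary_bounds:
  assumes "drawn n (Ordinary q p R) A"
  shows "1 \<le> p \<and> p < q \<and> q \<le> int n \<and> R \<subseteq> labels n \<inter> {p<..<q}"
proof -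
  have pq: "1 \<le> p" "q \<le> int n" "\<exists>f. descends {1..int n} q p R f" using assms by auto
  then have "p < q \<and> R \<subseteq> {1..int n} \<inter> {p<..<q}" using descends_bounds by blast
  then show ?thesis using pq(1,2) by (auto simp: in_labels_iff subset_iff)
qed

lemma drawn_Orbifold_bounds:
  assumes "drawn n (Orbifold p R) A"
  shows "p \<in> {1..int n} \<and> R \<subseteq> {1..<p}"
proof -
  have p: "p \<in> {1..int n}" "\<exists>f. descends {1..int n} p 0 R f" using assms by auto
  then show ?thesis using descends_positive by blast
qed

lemma drawn_Long_bounds:
  assumes "drawn n (Long p S q R) A"
  shows "p \<in> {1..int n} \<and> q \<in> {1..int n} \<and> p \<noteq> q \<and> S \<subseteq> {1..<p} \<and> R \<subseteq> {1..<q}"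
proof -
  have p: "p \<in> {1..int n} \<and> q \<in> {1..int n} \<and> p \<noteq> q" "\<exists>f. descends {1..int n} p 0 S f"
    "\<exists>f. descends {1..int n} q 0 R f" using assms by auto
  then show ?thesis using descends_positive by blast
qed

lemma lifts_Ordinary: "lifts n (Ordinary q p R) = {(q, p, R), neg_arc n (q, p, R)}"
  by (simp add: lifts_def)

lemma lifts_Orbifold: "drawn n (Orbifold p R) A \<Longrightarrow> lifts n (Orbifold p R) = {joined_arc p R p R}"
  by (auto simp: lifts_def neg_arc_joined_arc dest!: drawn_Orbifold_bounds simp del: drawn.simps)

lemma lifts_Long:
  "drawn n (Long p S q R) A \<Longrightarrow> lifts n (Long p S q R) = {joined_arc p S q R, joined_arc q R p S}"
  by (auto simp: lifts_def neg_arc_joined_arc dest!: drawn_Long_bounds simp del: drawn.simps)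

text \<open>Endpoints of equal sign occur only over ordinary arcs, and opposite endpoints
  \<open>q = - p\<close> distinguish orbifold arcs from long ones. Within a kind the lift determines
  all data, up to exchanging the pieces of a long arc.\<close>

lemma lifts_disjoint:
  assumes T: "drawn n T A" "t \<in> lifts n T" and T': "drawn n T' A'" "t \<in> lifts n T'"
  shows "T = T'"
proof -
  define pos where "pos = (\<lambda>t :: sym_arc. fst t > 0 \<and> fst (snd t) > 0 \<or> fst t < 0 \<and> fst (snd t) < 0)"
  have ordinary: "pos t" if "drawn n (Ordinary q p R) A" "t \<in> lifts n (Ordinary q p R)" for q p R A
    using that drawn_Ordinary_bounds[OF that(1)] by (auto simp: lifts_Ordinary pos_def)
  have joined: "\<not> pos (joined_arc p S q R)" if "p > 0" "q > 0" for p S q R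
    using that by (auto simp: joined_arc_def pos_def)
  have orbifold: "\<not> pos t" if "drawn n (Orbifold p R) A" "t \<in> lifts n (Orbifold p R)" for p R A
    using that drawn_Orbifold_bounds[OF that(1)] joined[of p p] by (auto simp: lifts_Orbifold[OF that(1)])
  have long: "\<not> pos t" if "drawn n (Long p S q R) A" "t \<in> lifts n (Long p S q R)" for p S q R A
    using that drawn_Long_bounds[OF that(1)] joined[of p q] joined[of q p]
    by (auto simp: lifts_Long[OF that(1)])
  have mixed: "False" if d: "drawn n (Orbifold p R) A" "t \<in> lifts n (Orbifold p R)"
      "drawn n (Long p' S' q' R') A'" "t \<in> lifts n (Long p' S' q' R')" for p R p' S' q' R' A A'
    using that(2,4) drawn_Long_bounds[OF that(3)]
    by (auto simp: lifts_Orbifold[OF that(1)] lifts_Long[OF that(3)] joined_arc_def)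
  show ?thesis
  proof (cases T)
    case O1: (Ordinary q p R)
    show ?thesis
    proof (cases T')
      case O2: (Ordinary q' p' R')
      note b = drawn_Ordinary_bounds[OF T(1)[unfolded O1]]
      note b' = drawn_Ordinary_bounds[OF T'(1)[unfolded O2]]
      have "fst (neg_arc n (q, p, R)) < 0" "fst (neg_arc n (q', p', R')) < 0" "0 < q" "0 < q'"
        using b b' by auto
      then have "(q, p, R) = (q', p', R') \<or> neg_arc n (q, p, R) = neg_arc n (q', p', R')"
        using T(2) T'(2) unfolding O1 O2 lifts_Ordinary
        by (metis fst_conv insertE less_asym singletonD)
      then have "(q, p, R) = (q', p', R')"
        using neg_arc_neg_arc[of R n p q] neg_arc_neg_arc[of R' n p' q'] b b' by metis
      then show ?thesis using O1 O2 by simp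
    qed (use T T' O1 ordinary orbifold long in blast)+
  next
    case B1: (Orbifold p R)
    show ?thesis
    proof (cases T')
      case (Orbifold p' R')
      then show ?thesis
        using T(2) T'(2) B1 lifts_Orbifold[OF T(1)[unfolded B1]] lifts_Orbifold[OF T'(1)[unfolded Orbifold]]
          drawn_Orbifold_bounds[OF T(1)[unfolded B1]] drawn_Orbifold_bounds[OF T'(1)[unfolded Orbifold]]
        by (auto dest!: joined_arc_inject[rotated 4])
    qed (use T T' B1 ordinary orbifold mixed in blast)+
  next
    case L1: (Long p S q R)
    show ?thesis
    proof (cases T')
      case L2: (Long p' S' q' R')
      note b = drawn_Long_bounds[OF T(1)[unfolded L1]]
      note b' = drawn_Long_bounds[OF T'(1)[unfolded L2]]
      have "joined_arc p S q R = joined_arc p' S' q' R' \<or> joined_arc p S q R = joined_arc q' R' p' S'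
          \<or> joined_arc q R p S = joined_arc p' S' q' R' \<or> joined_arc q R p S = joined_arc q' R' p' S'"
        using T(2) T'(2) L1 L2 lifts_Long[OF T(1)[unfolded L1]] lifts_Long[OF T'(1)[unfolded L2]] by auto
      then consider "p = p' \<and> S = S' \<and> q = q' \<and> R = R'" | "p = q' \<and> S = R' \<and> q = p' \<and> R = S'"
        using b b' joined_arc_inject[of S p S' p' R q R' q'] joined_arc_inject[of S p R' q' R q S' p']
          joined_arc_inject[of R q S' p' S p R' q'] joined_arc_inject[of R q R' q' S p S' p'] by auto
      then show ?thesis
      proof cases
        case 1
        then show ?thesis using L1 L2 by simp
      next
        \<comment> \<open>The exchanged labels make contradictory demands on the side of the lower
          top, so they cannot both be drawn.\<close>
        case 2
        then show ?thesis
          using drawn_Long_sides[OF T(1)[unfolded L1]] drawn_Long_sides[OF T'(1)[unfolded L2]] b by auto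
      qed
    qed (use T T' L1 ordinary long mixed in blast)+
  qed
qed

section \<open>Gluing and cutting curves at the horizontal axis\<close>

lemma descends_labels_iff:
  assumes "0 \<le> p"
  shows "descends (labels n) q p R f \<longleftrightarrow> descends {1..int n} q p R f"
proof -
  have "labels n \<inter> {p<..<q} = {1..int n} \<inter> {p<..<q}" using assms by (auto simp: labels_def)
  then show ?thesis by (simp add: descends_def)
qed

text \<open>The condition on \<open>g 0\<close> says that the pieces reach the axis at opposite
  points, so the half-turned second piece continues the first.\<close>

lemma drawn_sym_joined_arc:
  assumes p: "p \<in> {1..int n}" and q: "q \<in> {1..int n}" and f: "descends {1..int n} p 0 S f"
    and g: "descends {1..int n} q 0 R g" and "g 0 = - f 0"
  shows "drawn_sym n (joined_arc p S q R) (curve f p 0 \<union> uminus ` curve g q 0)"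
proof -
  define h where "h = (\<lambda>y. if 0 \<le> y then f y else - g (- y))"
  have cont: "continuous_on {0..real_of_int p} f" "continuous_on {0..real_of_int q} g"
    using f g by (auto simp: descends_def)
  have "continuous_on ({0..real_of_int p} \<union> {- real_of_int q..0}) h"
    unfolding h_def
  proof (rule continuous_on_cases)
    show "continuous_on {- real_of_int q..0} (\<lambda>y. - g (- y))"
      using continuous_on_half_turn[OF cont(2)] by simp
  qed (use cont assms(5) in auto)
  moreover have "{0..real_of_int p} \<union> {- real_of_int q..0} = {real_of_int (- q)..real_of_int p}"
    using p q by auto
  ultimately have conth: "continuous_on {real_of_int (- q)..real_of_int p} h" by simp
  define Q where "Q = S \<union> {c. - q < c \<and> c < 0 \<and> - c \<notin> R}"
  have sub: "S \<subseteq> {1..<p}" using descends_positive[OF f] .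
  have zero: "f (real_of_int p) = 0" "g (real_of_int q) = 0" using f g by (auto simp: descends_def)
  have "descends (labels n) p (- q) Q h"
    unfolding descends_def
  proof (intro conjI ballI)
    show "- q < p" using p q by auto
    show "h (real_of_int p) = 0" using p zero by (simp add: h_def)
    show "Q \<subseteq> labels n \<inter> {- q<..<p}" using sub p q by (auto simp: Q_def in_labels_iff)
    fix i assume i: "i \<in> labels n \<inter> {- q<..<p}"
    show "if i \<in> Q then 0 < h (real_of_int i) else h (real_of_int i) < 0"
    proof (cases "0 < i")
      case True
      then have "i \<in> Q \<longleftrightarrow> i \<in> S" "h (real_of_int i) = f (real_of_int i)"
        by (auto simp: Q_def h_def)
      moreover have "if i \<in> S then 0 < f (real_of_int i) else f (real_of_int i) < 0"
        using f i True p unfolding descends_def by simp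
      ultimately show ?thesis by simp
    next
      case False
      then have "i < 0" using i by (auto simp: in_labels_iff)
      then have "i \<in> Q \<longleftrightarrow> - i \<notin> R" "h (real_of_int i) = - g (real_of_int (- i))"
        using i sub by (auto simp: Q_def h_def)
      moreover have "- i \<in> {1..int n} \<inter> {0<..<q}" using i \<open>i < 0\<close> q by auto
      then have "if - i \<in> R then 0 < g (real_of_int (- i)) else g (real_of_int (- i)) < 0"
        using g unfolding descends_def by blast
      ultimately show ?thesis by (simp split: if_splits)
    qed
  qed (use conth in auto)
  moreover have "h (real_of_int (- q)) = 0" using q zero by (simp add: h_def)
  moreover have "curve f p 0 \<union> uminus ` curve g q 0 = curve h p (- q)"
  proof -
    have "x \<in> curve f p 0 \<union> uminus ` curve g q 0 \<longleftrightarrow> x \<in> curve h p (- q)" for x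
    proof (cases x)
      case (Pair a y)
      show ?thesis
        unfolding image_uminus_curve Pair using p q assms(5)
        by (cases "y = 0") (auto simp: in_curve_iff h_def)
    qed
    then show ?thesis by blast
  qed
  ultimately show ?thesis
    using p q by (auto simp: joined_arc_def Q_def in_labels_iff intro!: exI[of _ h])
qed

lemma cut_drawn_sym:
  assumes "drawn_sym n (q, p, R) C" "p < 0" "0 < q"
  obtains f S where "q \<in> {1..int n}" "- p \<in> {1..int n}" "descends {1..int n} q 0 (R \<inter> {0<..}) f"
    "descends {1..int n} (- p) 0 S (\<lambda>y. - f (- y))" "C = curve f q p"
    "C = curve f q 0 \<union> uminus ` curve (\<lambda>y. - f (- y)) (- p) 0"
proof -
  obtain f where f: "q \<in> labels n" "p \<in> labels n" "p < q" "descends (labels n) q p R f"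
    "continuous_on {real_of_int p..real_of_int q} f"
    "f (real_of_int q) = 0" "f (real_of_int p) = 0" "C = curve f q p"
    "R = {c \<in> labels n. p < c \<and> c < q \<and> 0 < f (real_of_int c)}"
    "\<And>c. c \<in> labels n \<Longrightarrow> p < c \<Longrightarrow> c < q \<Longrightarrow> f (real_of_int c) \<noteq> 0"
    using assms(1) by (rule drawn_symE) blast
  have qp: "q \<in> {1..int n}" "- p \<in> {1..int n}" using f(1,2) assms by (auto simp: in_labels_iff)
  have upper: "descends {1..int n} q 0 (R \<inter> {0<..}) f"
    unfolding descends_def
  proof (intro conjI ballI)
    show "continuous_on {real_of_int 0..real_of_int q} f"
      using f(5) assms(2) by (auto elim: continuous_on_subset)
    show "R \<inter> {0<..} \<subseteq> {1..int n} \<inter> {0<..<q}" using f(9) by (auto simp: in_labels_iff)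
    fix i assume i: "i \<in> {1..int n} \<inter> {0<..<q}"
    then show "if i \<in> R \<inter> {0<..} then 0 < f (real_of_int i) else f (real_of_int i) < 0"
      using f(9) f(10)[of i] assms(2) by (auto simp: in_labels_iff)
  qed (use f assms in auto)
  \<comment> \<open>The half-turn reverses signs: the turned lower part is right of \<open>c\<close>
    when the curve is left of \<open>- c\<close>.\<close>
  define S where "S = {c \<in> {1..<- p}. f (- real_of_int c) < 0}"
  have lower: "descends {1..int n} (- p) 0 S (\<lambda>y. - f (- y))"
    unfolding descends_def
  proof (intro conjI ballI)
    have "continuous_on {- 0..- real_of_int p} (\<lambda>y. - f (- y))"
      using f(5) assms(3) by (intro continuous_on_half_turn) (auto elim: continuous_on_subset)
    then show "continuous_on {real_of_int 0..real_of_int (- p)} (\<lambda>y. - f (- y))" by simp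
    show "S \<subseteq> {1..int n} \<inter> {0<..<- p}" using qp by (auto simp: S_def)
    fix i assume i: "i \<in> {1..int n} \<inter> {0<..<- p}"
    then show "if i \<in> S then 0 < - f (- real_of_int i) else - f (- real_of_int i) < 0"
      using f(10)[of "- i"] assms(3) by (auto simp: S_def in_labels_iff)
  qed (use f assms in auto)
  have "x \<in> C \<longleftrightarrow> x \<in> curve f q 0 \<union> uminus ` curve (\<lambda>y. - f (- y)) (- p) 0" for x
    unfolding image_uminus_curve f(8) using assms(2,3) by (cases x) (auto simp: in_curve_iff)
  then have "C = curve f q 0 \<union> uminus ` curve (\<lambda>y. - f (- y)) (- p) 0" by blast
  then show thesis using that[OF qp upper lower f(8)] by blast
qed

lemma exists_lift:
  assumes "drawn n T A"
  shows "\<exists>K. drawn_sym n (base_lift T) K \<and> phi ` K = A \<and> symmetric_or_disjoint K"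
proof (cases T)
  case (Ordinary q p R)
  then obtain f where f: "q \<in> {1..int n}" "p \<in> {1..int n}" "descends {1..int n} q p R f"
    "f (real_of_int p) = 0" "A = phi ` curve f q p"
    using assms by auto
  have "uminus ` curve f q p \<inter> curve f q p = {}"
    using f(1,2) by (auto simp: image_uminus_curve in_curve_iff)
  then show ?thesis
    using f descends_labels_iff[of p n q R f] unfolding Ordinary
    by (intro exI[of _ "curve f q p"]) (auto simp: symmetric_or_disjoint_def in_labels_iff)
next
  case (Orbifold p R)
  then obtain f where f: "p \<in> {1..int n}" "descends {1..int n} p 0 R f" "f 0 = 0" "A = phi ` curve f p 0"
    using assms by auto
  show ?thesis
    using drawn_sym_joined_arc[OF f(1,1,2,2)] f(3,4) unfolding Orbifold
    by (intro exI[of _ "curve f p 0 \<union> uminus ` curve f p 0"])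
      (auto simp: symmetric_or_disjoint_def image_Un simp del: drawn_sym.simps)
next
  case (Long p S q R)
  then obtain r f g where f: "p \<in> {1..int n}" "q \<in> {1..int n}" "r > 0"
    "descends {1..int n} p 0 S f" "f 0 = - r" "descends {1..int n} q 0 R g" "g 0 = r"
    "curve f p 0 \<inter> curve g q 0 = {}" "A = phi ` (curve f p 0 \<union> curve g q 0)"
    using assms by auto
  define K where "K = curve f p 0 \<union> uminus ` curve g q 0"
  have K: "drawn_sym n (base_lift T) K"
    unfolding K_def Long using drawn_sym_joined_arc[OF f(1,2,4,6)] f(5,7) by simp
  have A: "phi ` K = A" by (simp add: K_def f(9) image_Un)
  have "uminus ` K \<inter> K = {}"
  proof -
    have "x \<notin> uminus ` K \<inter> K" for x
    proof
      assume "x \<in> uminus ` K \<inter> K"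
      \<comment> \<open>A piece and its own half-turn can meet only at height 0, where
        \<open>r > 0\<close> keeps them apart; the other two cases are excluded by disjointness of
        the pieces.\<close>
      then have "x \<in> uminus ` curve f p 0 \<and> x \<in> curve f p 0 \<or> x \<in> uminus ` curve g q 0 \<and> x \<in> curve g q 0
        \<or> - x \<in> curve f p 0 \<inter> curve g q 0 \<or> x \<in> curve f p 0 \<inter> curve g q 0"
        unfolding K_def image_Un by auto
      then show False
        using f(3,5,7,8) by (cases x) (auto simp: image_uminus_curve in_curve_iff)
    qed
    then show ?thesis by blast
  qed
  then show ?thesis using K A by (auto simp: symmetric_or_disjoint_def)
qed

text \<open>Crossing the axis left of the origin makes the upper part of \<open>C\<close> the left
  piece and the half-turned lower part the right piece. They are disjoint because they lie in
  \<open>C\<close> and its half-turn.\<close>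

lemma exists_projection_left:
  assumes C: "drawn_sym n (q, p, R) C" and pq: "p < 0" "0 < q" "q \<noteq> - p"
    and disj: "uminus ` C \<inter> C = {}" and left: "\<And>x. (x, 0) \<in> C \<Longrightarrow> x < 0"
  shows "\<exists>T. drawn n T (phi ` C)"
proof -
  obtain f S where f: "q \<in> {1..int n}" "- p \<in> {1..int n}" "descends {1..int n} q 0 (R \<inter> {0<..}) f"
    "descends {1..int n} (- p) 0 S (\<lambda>y. - f (- y))" "C = curve f q p"
    "C = curve f q 0 \<union> uminus ` curve (\<lambda>y. - f (- y)) (- p) 0"
    using cut_drawn_sym[OF C pq(1,2)] .
  have "f 0 < 0" using left[of "f 0"] pq by (simp add: f(5) in_curve_iff)
  moreover have "curve f q 0 \<subseteq> C" "curve (\<lambda>y. - f (- y)) (- p) 0 \<subseteq> uminus ` C"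
    unfolding f(6) by (auto simp: image_Un)
  then have "curve f q 0 \<inter> curve (\<lambda>y. - f (- y)) (- p) 0 = {}" using disj by blast
  moreover have "phi ` C = phi ` (curve f q 0 \<union> curve (\<lambda>y. - f (- y)) (- p) 0)"
    unfolding f(6) by (simp add: image_Un)
  ultimately have "drawn n (Long q (R \<inter> {0<..}) (- p) S) (phi ` C)"
    unfolding drawn.simps using f(1-4) pq(3)
    by (intro conjI exI[of _ "- f 0"] exI[of _ f] exI[of _ "\<lambda>y. - f (- y)"]) simp_all
  then show ?thesis ..
qed

lemma exists_projection_upper:
  assumes "drawn_sym n (q, p, R) C" "0 < p"
  shows "\<exists>T. drawn n T (phi ` C)"
proof -
  obtain f where f: "q \<in> labels n" "p \<in> labels n" "p < q" "descends (labels n) q p R f"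
    "f (real_of_int p) = 0" "C = curve f q p"
    using assms(1) by (rule drawn_symE) blast
  then have "drawn n (Ordinary q p R) (phi ` C)"
    using assms(2) descends_labels_iff[of p n q R f] by (auto simp: in_labels_iff)
  then show ?thesis ..
qed

lemma exists_projection:
  assumes C: "drawn_sym n t C" and nice: "symmetric_or_disjoint C"
  shows "\<exists>T. drawn n T (phi ` C)"
proof -
  obtain q p R where t: "t = (q, p, R)" by (metis prod_cases3)
  note C' = C[unfolded t]
  obtain R' where neg: "drawn_sym n (- p, - q, R') (uminus ` C)"
    using drawn_sym_uminus[OF C'] unfolding neg_arc.simps by blast
  obtain f where f: "q \<in> labels n" "p \<in> labels n" "p < q" "f (real_of_int q) = 0" "f (real_of_int p) = 0"
    "C = curve f q p"
    using C' by (rule drawn_symE) blast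
  consider "0 < p" | "q < 0" | "p < 0" "0 < q" "q = - p" | "p < 0" "0 < q" "q \<noteq> - p"
    using f(1-3) by (force simp: in_labels_iff)
  then show ?thesis
  proof cases
    case 1
    then show ?thesis using exists_projection_upper C' by blast
  next
    case 2
    then show ?thesis using exists_projection_upper[OF neg] by simp
  next
    case 3
    obtain g S where g: "q \<in> {1..int n}" "descends {1..int n} q 0 (R \<inter> {0<..}) g" "C = curve g q p"
      "C = curve g q 0 \<union> uminus ` curve (\<lambda>y. - g (- y)) (- p) 0"
      using cut_drawn_sym[OF C' 3(1,2)] by metis
    \<comment> \<open>Curve and half-turn share their endpoints, so they cannot be disjoint. They
      coincide, which makes the coordinate function odd and leads it through the origin.\<close>
    have "(0, real_of_int q) \<in> C" "(0, - real_of_int q) \<in> C"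
      using f 3 by (auto simp: in_curve_iff)
    moreover from this(2) have "(0, real_of_int q) \<in> uminus ` C" by force
    ultimately have sym: "uminus ` C = C" using nice by (auto simp: symmetric_or_disjoint_def)
    have odd: "- g (- y) = g y" if "real_of_int p \<le> y" "y \<le> real_of_int q" for y
    proof -
      have "(g y, y) \<in> C" using that by (simp add: g(3) in_curve_iff)
      then have "(g y, y) \<in> uminus ` C" by (simp only: sym)
      then show ?thesis unfolding g(3) image_uminus_curve by (simp add: in_curve_iff)
    qed
    then have "curve (\<lambda>y. - g (- y)) (- p) 0 = curve g q 0"
      using 3 by (auto intro!: curve_cong)
    then have "phi ` C = phi ` curve g q 0" unfolding g(4) by (simp add: image_Un)
    moreover have "g 0 = 0" using odd[of 0] 3 by simp
    ultimately have "drawn n (Orbifold q (R \<inter> {0<..})) (phi ` C)" using g(1,2) by auto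
    then show ?thesis ..
  next
    case 4
    \<comment> \<open>The endpoints of the half-turned arc differ, so only disjointness remains, and
      the curve must miss the origin.\<close>
    have "uminus ` C \<noteq> C"
      using drawn_sym_unique[OF neg] C' 4 by fastforce
    then have disj: "uminus ` C \<inter> C = {}" using nice by (auto simp: symmetric_or_disjoint_def)
    have zero: "(x, 0) \<in> C \<longleftrightarrow> x = f 0" for x using 4 f(6) by (auto simp: in_curve_iff)
    have "f 0 \<noteq> 0"
    proof
      assume "f 0 = 0"
      then have "(0, 0) \<in> C" using zero by simp
      then have "(0, 0) \<in> uminus ` C \<inter> C" by force
      then show False using disj by simp
    qed
    then consider "f 0 < 0" | "f 0 > 0" by linarith
    then show ?thesis
    proof cases
      case 1
      then show ?thesis using exists_projection_left[OF C' 4 disj] zero by simp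
    next
      \<comment> \<open>The half-turned curve has the same image and crosses the axis on the
        left.\<close>
      case 2
      have "x < 0" if "(x, 0) \<in> uminus ` C" for x
        using that zero[of "- x"] 2 by force
      then have "\<exists>T. drawn n T (phi ` uminus ` C)"
        using 4 disj by (intro exists_projection_left[OF neg]) (auto simp: Int_commute)
      then show ?thesis by simp
    qed
  qed
qed

text \<open>The drawing of \<open>T\<close> has a lift \<open>K\<close> of known class with the same
  image as \<open>C\<close>. Hence \<open>C\<close> is \<open>K\<close> or its half-turn, and the
  class of a curve is unique.\<close>

lemma projection_in_lifts:
  assumes C: "drawn_sym n t C" "symmetric_or_disjoint C" and T: "drawn n T (phi ` C)"
  shows "t \<in> lifts n T"
proof -
  obtain K where K: "drawn_sym n (base_lift T) K" "phi ` K = phi ` C" "symmetric_or_disjoint K"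
    using exists_lift[OF T] by blast
  have "C = K \<or> C = uminus ` K"
    using half_turn_lift_unique compact_connected_drawn_sym[OF C(1)] compact_connected_drawn_sym[OF K(1)]
      C(2) K(2,3) by (simp add: phi_image_eq_iff)
  then show ?thesis
    using drawn_sym_unique[OF C(1)] K(1) drawn_sym_uminus[OF K(1)] unfolding lifts_def by blast
qed

section \<open>The bijection\<close>

lemma neg_arc_in_delta:
  assumes C: "symmetric_drawing n (delta n \<pi>) C" and t: "t \<in> delta n \<pi>"
  shows "neg_arc n t \<in> delta n \<pi>" "C (neg_arc n t) = uminus ` C t"
proof -
  obtain s where s: "s \<in> delta n \<pi>" "uminus ` C t = C s"
    using C t by (auto simp: symmetric_drawing_def)
  have "drawn_sym n t (C t)" "drawn_sym n s (C s)" using C t s by (auto simp: symmetric_drawing_def)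
  then have "s = neg_arc n t" using drawn_sym_uminus drawn_sym_unique s(2) by metis
  then show "neg_arc n t \<in> delta n \<pi>" "C (neg_arc n t) = uminus ` C t" using s by simp_all
qed

text \<open>As 0 is no label, a non-symmetric arc could share an endpoint with its half-turn only if
  \<open>q = - p\<close>. Then two distinct descent arcs would have the same top. Without common
  endpoints the two curves are disjoint.\<close>

lemma symmetric_or_disjoint_drawing:
  assumes inj: "inj \<pi>" and C: "symmetric_drawing n (delta n \<pi>) C" and t: "t \<in> delta n \<pi>"
  shows "symmetric_or_disjoint (C t)"
proof -
  obtain q p R where qp: "t = (q, p, R)" by (metis prod_cases3)
  define s where "s = neg_arc n t"
  have s: "s \<in> delta n \<pi>" "C s = uminus ` C t" unfolding s_def using neg_arc_in_delta[OF C t] by auto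
  show ?thesis
  proof (cases "s = t")
    case True
    then show ?thesis using s(2) by (simp add: symmetric_or_disjoint_def)
  next
    case False
    have "drawn_sym n t (C t)" using C t by (simp add: symmetric_drawing_def)
    then have labels: "q \<in> labels n" "p \<in> labels n" unfolding qp by auto
    have "q \<noteq> - p"
    proof
      assume "q = - p"
      then obtain p' R' where "s = (q, p', R')" unfolding s_def qp by simp
      then show False using delta_top_unique[OF inj] s(1) t qp False by blast
    qed
    then have "ends_sym s \<inter> ends_sym t = {}"
      using labels by (auto simp: s_def qp in_labels_iff)
    moreover have "C s \<inter> C t \<subseteq> (\<lambda>i. (0, real_of_int i)) ` (ends_sym s \<inter> ends_sym t)"
      using C s(1) t False unfolding symmetric_drawing_def by blast
    ultimately show ?thesis using s(2) by (simp add: symmetric_or_disjoint_def)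
  qed
qed

text \<open>Removes the choice of a drawing. Drawability of \<open>T\<close> stays in the criterion
  because a long arc and its undrawable exchanged label have the same lifts.\<close>

lemma delta_orb_iff:
  assumes \<pi>: "\<pi> \<in> signed_perms n"
  shows "T \<in> delta_orb n \<pi> \<longleftrightarrow> (\<exists>A. drawn n T A) \<and> lifts n T \<inter> delta n \<pi> \<noteq> {}"
proof
  have inj: "inj \<pi>" using signed_permsD(1)[OF \<pi>] by (rule permutes_inj)
  show "(\<exists>A. drawn n T A) \<and> lifts n T \<inter> delta n \<pi> \<noteq> {}" if T: "T \<in> delta_orb n \<pi>"
  proof -
    obtain C t where C: "symmetric_drawing n (delta n \<pi>) C" "t \<in> delta n \<pi>" "drawn n T (phi ` C t)"
      using T unfolding delta_orb_def by blast
    moreover have "drawn_sym n t (C t)" using C by (simp add: symmetric_drawing_def)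
    ultimately have "t \<in> lifts n T"
      using projection_in_lifts symmetric_or_disjoint_drawing[OF inj] by blast
    then show ?thesis using C by blast
  qed
  assume "(\<exists>A. drawn n T A) \<and> lifts n T \<inter> delta n \<pi> \<noteq> {}"
  then obtain A t where T: "drawn n T A" "t \<in> lifts n T" "t \<in> delta n \<pi>" by blast
  obtain C where C: "symmetric_drawing n (delta n \<pi>) C" using exists_symmetric_drawing[OF \<pi>] ..
  have t: "drawn_sym n t (C t)" "symmetric_or_disjoint (C t)"
    using C T(3) symmetric_or_disjoint_drawing[OF inj] by (auto simp: symmetric_drawing_def)
  obtain T' where T': "drawn n T' (phi ` C t)" using exists_projection[OF t] ..
  then have "T = T'" using lifts_disjoint[OF T(1,2) T'] projection_in_lifts[OF t T'] by simp
  then show "T \<in> delta_orb n \<pi>" using C T(3) T' by (auto simp: delta_orb_def)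
qed

lemma lifts_eq:
  assumes "drawn n T A" "t \<in> lifts n T"
  shows "lifts n T = {t, neg_arc n t}"
proof -
  obtain K where K: "drawn_sym n (base_lift T) K" using exists_lift[OF assms(1)] by blast
  \<comment> \<open>A curve turned twice is the same curve, so its unique class shows that
    \<open>neg_arc\<close> is an involution here.\<close>
  have "drawn_sym n (neg_arc n (neg_arc n (base_lift T))) K"
    using drawn_sym_uminus[OF drawn_sym_uminus[OF K]] by simp
  then have "neg_arc n (neg_arc n (base_lift T)) = base_lift T"
    using K drawn_sym_unique by blast
  then show ?thesis using assms(2) unfolding lifts_def by auto
qed

lemma drawing_projection:
  assumes \<pi>: "\<pi> \<in> signed_perms n" and C: "symmetric_drawing n (delta n \<pi>) C" and t: "t \<in> delta n \<pi>"
  shows "\<exists>T\<in>delta_orb n \<pi>. drawn n T (phi ` C t) \<and> t \<in> lifts n T"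
proof -
  have "inj \<pi>" using signed_permsD(1)[OF \<pi>] by (rule permutes_inj)
  then have t': "drawn_sym n t (C t)" "symmetric_or_disjoint (C t)"
    using C t symmetric_or_disjoint_drawing by (auto simp: symmetric_drawing_def)
  then obtain T where "drawn n T (phi ` C t)" using exists_projection by blast
  then show ?thesis using t projection_in_lifts[OF t'] C by (auto simp: delta_orb_def)
qed

text \<open>The right-hand side depends on \<open>\<pi>\<close> only through
  \<open>delta_orb n \<pi>\<close>, so injectivity reduces to that of \<open>delta\<close>.\<close>

lemma delta_eq_Union_lifts:
  assumes \<pi>: "\<pi> \<in> signed_perms n"
  shows "delta n \<pi> = (\<Union>T\<in>delta_orb n \<pi>. lifts n T)"
proof -
  obtain C where C: "symmetric_drawing n (delta n \<pi>) C" using exists_symmetric_drawing[OF \<pi>] ..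
  have "lifts n T \<subseteq> delta n \<pi>" if "T \<in> delta_orb n \<pi>" for T
  proof -
    obtain A t where t: "drawn n T A" "t \<in> lifts n T" "t \<in> delta n \<pi>"
      using \<open>T \<in> delta_orb n \<pi>\<close> unfolding delta_orb_iff[OF \<pi>] by blast
    then show ?thesis using lifts_eq[OF t(1,2)] neg_arc_in_delta(1)[OF C t(3)] by simp
  qed
  then show ?thesis using drawing_projection[OF \<pi> C] by blast
qed

section \<open>Endpoints of an arc and of its lifts\<close>

lemma down_end_lift:
  assumes T: "drawn n T A" and i: "i \<in> down_ends T"
  shows "\<exists>p R. (i, p, R) \<in> lifts n T"
proof (cases T)
  case (Ordinary q p R)
  then show ?thesis using i by (auto simp: lifts_def)
next
  case (Orbifold p R)
  then show ?thesis using i by (auto simp: lifts_def joined_arc_def)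
next
  case (Long p S q R)
  then show ?thesis
    using i lifts_Long[OF T[unfolded Long]] by (auto simp: joined_arc_def)
qed

lemma up_end_lift: "i \<in> up_ends T \<Longrightarrow> \<exists>q R. (q, i, R) \<in> lifts n T"
  by (cases T) (auto simp: lifts_def)

text \<open>The half-turn exchanges top and bottom, so a bottom below the origin is a downward end
  in the orbifold, and a top below it an upward end.\<close>

lemma lift_ends:
  assumes T: "drawn n T A" and t: "(q, p, R) \<in> lifts n T"
  shows "0 < q \<Longrightarrow> q \<in> down_ends T" "q < 0 \<Longrightarrow> - q \<in> up_ends T"
    "0 < p \<Longrightarrow> p \<in> up_ends T" "p < 0 \<Longrightarrow> - p \<in> down_ends T"
proof -
  have "(0 < q \<longrightarrow> q \<in> down_ends T) \<and> (q < 0 \<longrightarrow> - q \<in> up_ends T) \<and>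
    (0 < p \<longrightarrow> p \<in> up_ends T) \<and> (p < 0 \<longrightarrow> - p \<in> down_ends T)"
  proof (cases T)
    case (Ordinary q' p' R')
    then show ?thesis
      using t drawn_Ordinary_bounds[OF T[unfolded Ordinary]] by (auto simp: lifts_def)
  next
    case (Orbifold p' R')
    then show ?thesis
      using t drawn_Orbifold_bounds[OF T[unfolded Orbifold]] lifts_Orbifold[OF T[unfolded Orbifold]]
      by (auto simp: joined_arc_def)
  next
    case (Long p' S' q' R')
    then show ?thesis
      using t drawn_Long_bounds[OF T[unfolded Long]] lifts_Long[OF T[unfolded Long]]
      by (auto simp: joined_arc_def)
  qed
  then show "0 < q \<Longrightarrow> q \<in> down_ends T" "q < 0 \<Longrightarrow> - q \<in> up_ends T"
    "0 < p \<Longrightarrow> p \<in> up_ends T" "p < 0 \<Longrightarrow> - p \<in> down_ends T" by blast+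
qed

text \<open>The two lifts of an ordinary arc have endpoints of opposite sign, and those of a long
  arc have different tops and bottoms since \<open>p \<noteq> q\<close>.\<close>

lemma lifts_same_end:
  assumes T: "drawn n T A" and s: "(q, p, R) \<in> lifts n T" and t: "(q', p', R') \<in> lifts n T"
    and "q = q' \<or> p = p'"
  shows "(q, p, R) = (q', p', R')"
proof (cases T)
  case (Ordinary a b X)
  then show ?thesis
    using s t assms(4) drawn_Ordinary_bounds[OF T[unfolded Ordinary]] by (auto simp: lifts_def)
next
  case (Orbifold p R)
  then show ?thesis
    using s t lifts_Orbifold[OF T[unfolded Orbifold]] by auto
next
  case (Long a S b X)
  then show ?thesis
    using s t assms(4) drawn_Long_bounds[OF T[unfolded Long]] lifts_Long[OF T[unfolded Long]]
    by (auto simp: joined_arc_def)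
qed

lemma delta_orb_in_typeB_diagrams:
  assumes \<pi>: "\<pi> \<in> signed_perms n"
  shows "delta_orb n \<pi> \<in> typeB_diagrams n"
proof -
  have inj: "inj \<pi>" using signed_permsD(1)[OF \<pi>] by (rule permutes_inj)
  obtain C where C: "symmetric_drawing n (delta n \<pi>) C" using exists_symmetric_drawing[OF \<pi>] ..
  have ex: "\<exists>t. t \<in> delta n \<pi> \<and> t \<in> lifts n T \<and> drawn n T (phi ` C t)" if T: "T \<in> delta_orb n \<pi>" for T
  proof -
    obtain A t where t: "drawn n T A" "t \<in> lifts n T" "t \<in> delta n \<pi>"
      using T unfolding delta_orb_iff[OF \<pi>] by blast
    obtain T' where T': "drawn n T' (phi ` C t)" "t \<in> lifts n T'"
      using drawing_projection[OF \<pi> C t(3)] by blast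
    then show ?thesis using lifts_disjoint[OF t(1,2) T'] t by blast
  qed
  \<comment> \<open>One lift per class, all taken from the same drawing, so that crossings
    downstairs can be compared with crossings in it.\<close>
  then obtain l where l: "\<And>T. T \<in> delta_orb n \<pi> \<Longrightarrow> l T \<in> delta n \<pi>"
    "\<And>T. T \<in> delta_orb n \<pi> \<Longrightarrow> l T \<in> lifts n T"
    "\<And>T. T \<in> delta_orb n \<pi> \<Longrightarrow> drawn n T (phi ` C (l T))"
    by metis
  have in_delta: "lifts n T \<subseteq> delta n \<pi>" if "T \<in> delta_orb n \<pi>" for T
    using that delta_eq_Union_lifts[OF \<pi>] by blast
  have disjoint: "lifts n S \<inter> lifts n T = {}" if "S \<in> delta_orb n \<pi>" "T \<in> delta_orb n \<pi>" "S \<noteq> T" for S T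
    using lifts_disjoint l(3) that by blast
  have "phi ` C (l S) \<inter> phi ` C (l T) \<subseteq> (\<lambda>i. Upper 0 (real_of_int i)) ` (ends S \<inter> ends T) \<and>
      down_ends S \<inter> down_ends T = {} \<and> up_ends S \<inter> up_ends T = {}"
    if ST: "S \<in> delta_orb n \<pi>" "T \<in> delta_orb n \<pi>" "S \<noteq> T" for S T
  proof (intro conjI)
    have endsD: "\<bar>i\<bar> \<in> ends U" if "i \<in> ends_sym u" "u \<in> lifts n U" "U \<in> delta_orb n \<pi>" "i \<in> labels n" for i u U
    proof -
      obtain q p R where u: "u = (q, p, R)" by (metis prod_cases3)
      show ?thesis
        using lift_ends[OF l(3)[OF that(3)] that(2)[unfolded u]] that(1,4)
        by (auto simp: ends_def u in_labels_iff abs_if)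
    qed
    have crossing: "phi x \<in> (\<lambda>i. Upper 0 (real_of_int i)) ` (ends S \<inter> ends T)"
      if st: "s \<in> lifts n S" "t \<in> lifts n T" and x: "x \<in> C s \<inter> C t" for s t x
    proof -
      have delta: "s \<in> delta n \<pi>" "t \<in> delta n \<pi>" "s \<noteq> t" using st ST in_delta disjoint by blast+
      then obtain i where i: "x = (0, real_of_int i)" "i \<in> ends_sym s" "i \<in> ends_sym t"
        using C x unfolding symmetric_drawing_def by blast
      have "drawn_sym n s (C s)" using C delta by (simp add: symmetric_drawing_def)
      then have lab: "i \<in> labels n" using i(2) by (cases s) auto
      have "\<bar>i\<bar> \<in> ends S \<inter> ends T" using endsD i lab st ST by blast
      moreover have "phi x = Upper 0 (real_of_int \<bar>i\<bar>)" using i(1) lab by (auto simp: in_labels_iff)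
      ultimately show ?thesis by blast
    qed
    show "phi ` C (l S) \<inter> phi ` C (l T) \<subseteq> (\<lambda>i. Upper 0 (real_of_int i)) ` (ends S \<inter> ends T)"
    proof
      fix z assume "z \<in> phi ` C (l S) \<inter> phi ` C (l T)"
      then obtain x y where xy: "x \<in> C (l S)" "z = phi x" "y \<in> C (l T)" "z = phi y" by blast
      \<comment> \<open>Two curves meet downstairs exactly when one of them meets the other or the
        half-turn of the other, which is again a curve of the drawing.\<close>
      then have "x = y \<or> x = - y" using phi_eq_iff by metis
      then have "x \<in> C (l S) \<inter> C (l T) \<or> x \<in> C (l S) \<inter> C (neg_arc n (l T))"
        using xy neg_arc_in_delta(2)[OF C l(1)[OF ST(2)]] by auto
      moreover have "l T \<in> lifts n T" "neg_arc n (l T) \<in> lifts n T"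
        using lifts_eq[OF l(3,2)[OF ST(2) ]] ST(2) by auto
      ultimately show "z \<in> (\<lambda>i. Upper 0 (real_of_int i)) ` (ends S \<inter> ends T)"
        using crossing l(2)[OF ST(1)] xy(2) by blast
    qed
    show "down_ends S \<inter> down_ends T = {}"
    proof (rule ccontr)
      assume "\<not> ?thesis"
      then obtain i where "i \<in> down_ends S" "i \<in> down_ends T" by blast
      then obtain p R p' R' where "(i, p, R) \<in> lifts n S" "(i, p', R') \<in> lifts n T"
        using down_end_lift[OF l(3)[OF ST(1)]] down_end_lift[OF l(3)[OF ST(2)]] by metis
      moreover from this have "p = p' \<and> R = R'" using delta_top_unique[OF inj] in_delta ST by blast
      ultimately show False using disjoint[OF ST] by blast
    qed
    show "up_ends S \<inter> up_ends T = {}"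
    proof (rule ccontr)
      assume "\<not> ?thesis"
      then obtain i where "i \<in> up_ends S" "i \<in> up_ends T" by blast
      then obtain p R p' R' where "(p, i, R) \<in> lifts n S" "(p', i, R') \<in> lifts n T"
        using up_end_lift by metis
      moreover from this have "p = p' \<and> R = R'" using delta_bottom_unique[OF inj] in_delta ST by blast
      ultimately show False using disjoint[OF ST] by blast
    qed
  qed
  then show ?thesis
    unfolding typeB_diagrams_def using l(3) by (intro CollectI exI[of _ "\<lambda>T. phi ` C (l T)"]) blast
qed

text \<open>Conjugation by negation; its fixed points among the permutations of the labels are the
  signed permutations.\<close>

definition half_turn :: "(int \<Rightarrow> int) \<Rightarrow> int \<Rightarrow> int" where
  "half_turn \<pi> i = - \<pi> (- i)"

lemma half_turn_half_turn [simp]: "half_turn (half_turn \<pi>) = \<pi>"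
  by (simp add: half_turn_def fun_eq_iff)

lemma half_turn_permutes:
  assumes "\<pi> permutes labels n"
  shows "half_turn \<pi> permutes labels n"
proof -
  have "bij_betw (\<lambda>i. - \<pi> (- i)) (labels n) (labels n)"
  proof (rule bij_betw_byWitness[where f' = "\<lambda>i. - inv \<pi> (- i)"])
    show "\<forall>a\<in>labels n. - inv \<pi> (- (- \<pi> (- a))) = a" "\<forall>a\<in>labels n. - \<pi> (- (- inv \<pi> (- a))) = a"
      using permutes_inverses[OF assms] by auto
    show "(\<lambda>i. - \<pi> (- i)) ` labels n \<subseteq> labels n" "(\<lambda>i. - inv \<pi> (- i)) ` labels n \<subseteq> labels n"
      using assms permutes_inv[OF assms] by (auto simp: permutes_in_image)
  qed
  then show ?thesis
    unfolding half_turn_def by (rule bij_imp_permutes) (simp add: permutes_not_in[OF assms])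
qed

text \<open>The descent from \<open>a\<close> to \<open>b\<close> becomes one from
  \<open>- b\<close> to \<open>- a\<close>. No position lies between \<open>a\<close> and
  \<open>b\<close>, so the values passed but not placed before \<open>a\<close> are those placed
  after \<open>b\<close>, which matches the complement in \<open>neg_arc\<close>.\<close>

lemma neg_arc_delta_subset:
  assumes perm: "\<pi> permutes labels n"
  shows "neg_arc n ` delta n \<pi> \<subseteq> delta n (half_turn \<pi>)"
proof
  fix s assume "s \<in> neg_arc n ` delta n \<pi>"
  then obtain a b where ab: "consecutive n a b" "\<pi> b < \<pi> a" and
    s: "s = neg_arc n (\<pi> a, \<pi> b, {\<pi> c |c. c \<in> labels n \<and> c < a \<and> \<pi> b < \<pi> c \<and> \<pi> c < \<pi> a})"
    by (auto elim!: deltaE simp del: neg_arc.simps)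
  have sep: "c \<le> a \<or> b \<le> c" if "c \<in> labels n" for c
    using ab(1) that unfolding consecutive_def by (auto simp: disjoint_iff not_less)
  have ab': "a < b" using ab(1) by (simp add: consecutive_def)
  let ?\<sigma> = "half_turn \<pi>"
  have inj: "\<pi> x = \<pi> y \<longleftrightarrow> x = y" for x y using perm by (simp add: permutes_inj inj_eq)
  have inl: "\<pi> x \<in> labels n \<longleftrightarrow> x \<in> labels n" for x using perm by (simp add: permutes_in_image)
  have "(\<exists>c. x = ?\<sigma> c \<and> c \<in> labels n \<and> c < - b \<and> ?\<sigma> (- a) < ?\<sigma> c \<and> ?\<sigma> c < ?\<sigma> (- b)) \<longleftrightarrow>
    x \<in> labels n \<and> - \<pi> a < x \<and> x < - \<pi> b \<and>
      \<not> (\<exists>c. - x = \<pi> c \<and> c \<in> labels n \<and> c < a \<and> \<pi> b < \<pi> c \<and> \<pi> c < \<pi> a)" for x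
  proof -
    obtain d where d: "x = - \<pi> d" using permutes_inverses(1)[OF perm, of "- x"] by (metis minus_minus)
    have "(\<exists>c. x = ?\<sigma> c \<and> c \<in> labels n \<and> c < - b \<and> ?\<sigma> (- a) < ?\<sigma> c \<and> ?\<sigma> c < ?\<sigma> (- b)) \<longleftrightarrow>
      d \<in> labels n \<and> b < d \<and> \<pi> b < \<pi> d \<and> \<pi> d < \<pi> a"
    proof
      assume "\<exists>c. x = ?\<sigma> c \<and> c \<in> labels n \<and> c < - b \<and> ?\<sigma> (- a) < ?\<sigma> c \<and> ?\<sigma> c < ?\<sigma> (- b)"
      then obtain c where c: "x = ?\<sigma> c" "c \<in> labels n" "c < - b" "?\<sigma> (- a) < ?\<sigma> c" "?\<sigma> c < ?\<sigma> (- b)" by blast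
      then have "d = - c" using d inj by (simp add: half_turn_def)
      then show "d \<in> labels n \<and> b < d \<and> \<pi> b < \<pi> d \<and> \<pi> d < \<pi> a"
        using c by (auto simp: half_turn_def)
    next
      assume "d \<in> labels n \<and> b < d \<and> \<pi> b < \<pi> d \<and> \<pi> d < \<pi> a"
      then show "\<exists>c. x = ?\<sigma> c \<and> c \<in> labels n \<and> c < - b \<and> ?\<sigma> (- a) < ?\<sigma> c \<and> ?\<sigma> c < ?\<sigma> (- b)"
        using d by (intro exI[of _ "- d"]) (auto simp: half_turn_def)
    qed
    moreover have "d \<in> labels n \<and> \<pi> b < \<pi> d \<and> \<pi> d < \<pi> a \<Longrightarrow> b < d \<longleftrightarrow> \<not> d < a"
      using sep[of d] ab' by (metis inj less_asym less_le_trans linorder_neqE order.order_iff_strict)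
    ultimately show ?thesis unfolding d using inj inl by auto
  qed
  then have R: "{?\<sigma> c |c. c \<in> labels n \<and> c < - b \<and> ?\<sigma> (- a) < ?\<sigma> c \<and> ?\<sigma> c < ?\<sigma> (- b)} =
    {x \<in> labels n. - \<pi> a < x \<and> x < - \<pi> b \<and>
      - x \<notin> {\<pi> c |c. c \<in> labels n \<and> c < a \<and> \<pi> b < \<pi> c \<and> \<pi> c < \<pi> a}}"
    by blast
  have "s = (?\<sigma> (- b), ?\<sigma> (- a), {?\<sigma> c |c. c \<in> labels n \<and> c < - b \<and> ?\<sigma> (- a) < ?\<sigma> c \<and> ?\<sigma> c < ?\<sigma> (- b)})"
    unfolding R s neg_arc.simps by (simp add: half_turn_def)
  then show "s \<in> delta n ?\<sigma>"
    using deltaI[OF consecutive_uminus[OF ab(1)], of ?\<sigma>] ab(2) by (simp add: half_turn_def)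
qed

lemma delta_half_turn:
  assumes perm: "\<pi> permutes labels n"
  shows "delta n (half_turn \<pi>) = neg_arc n ` delta n \<pi>"
proof
  show "delta n (half_turn \<pi>) \<subseteq> neg_arc n ` delta n \<pi>"
  proof
    fix t assume t: "t \<in> delta n (half_turn \<pi>)"
    then obtain a b where ab: "t = (half_turn \<pi> a, half_turn \<pi> b, {half_turn \<pi> c |c. c \<in> labels n \<and> c < a \<and>
       half_turn \<pi> b < half_turn \<pi> c \<and> half_turn \<pi> c < half_turn \<pi> a})"
      by (elim deltaE)
    have "neg_arc n (neg_arc n t) = t"
      unfolding ab using half_turn_permutes[OF perm]
      by (intro neg_arc_neg_arc) (auto simp: permutes_in_image)
    moreover have "neg_arc n t \<in> delta n \<pi>"
      using neg_arc_delta_subset[OF half_turn_permutes[OF perm]] t by auto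
    ultimately show "t \<in> neg_arc n ` delta n \<pi>" by (metis imageI)
  qed
qed (rule neg_arc_delta_subset[OF perm])

lemma typeB_diagrams_surjective:
  assumes X: "X \<in> typeB_diagrams n"
  shows "\<exists>\<pi>\<in>signed_perms n. delta_orb n \<pi> = X"
proof -
  obtain A where A1: "\<forall>T\<in>X. drawn n T (A T)"
    and A2: "\<forall>S\<in>X. \<forall>T\<in>X. S \<noteq> T \<longrightarrow>
      A S \<inter> A T \<subseteq> (\<lambda>i. Upper 0 (real_of_int i)) ` (ends S \<inter> ends T) \<and>
      down_ends S \<inter> down_ends T = {} \<and> up_ends S \<inter> up_ends T = {}"
    using X unfolding typeB_diagrams_def by (elim CollectE exE conjE)
  have A: "drawn n T (A T)" if "T \<in> X" for T using A1 that ..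
  have crossing: "A S \<inter> A T \<subseteq> (\<lambda>i. Upper 0 (real_of_int i)) ` (ends S \<inter> ends T)"
    and down: "down_ends S \<inter> down_ends T = {}" and up: "up_ends S \<inter> up_ends T = {}"
    if "S \<in> X" "T \<in> X" "S \<noteq> T" for S T
    using A2[rule_format, OF that] by blast+
  have "\<forall>T\<in>X. \<exists>K. drawn_sym n (base_lift T) K \<and> phi ` K = A T \<and> symmetric_or_disjoint K"
    using exists_lift A by blast
  then obtain K where K: "\<And>T. T \<in> X \<Longrightarrow> drawn_sym n (base_lift T) (K T)"
    "\<And>T. T \<in> X \<Longrightarrow> phi ` K T = A T" "\<And>T. T \<in> X \<Longrightarrow> symmetric_or_disjoint (K T)"
    by metis
  define D where "D = (\<Union>T\<in>X. lifts n T)"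
  \<comment> \<open>Curves of all arcs in \<open>D\<close> are taken from the chosen lifts
    \<open>K T\<close> and their half-turns, so that a crossing upstairs can be projected to the
    given drawing.\<close>
  define P where "P = (\<lambda>(q, p, R) f. q \<in> labels n \<and> p \<in> labels n \<and> descends (labels n) q p R f \<and>
      f (real_of_int p) = 0 \<and> (\<exists>T\<in>X. (q, p, R) \<in> lifts n T \<and> (curve f q p = K T \<or> curve f q p = uminus ` K T)))"
  have "\<exists>f. P t f" if t: "t \<in> D" for t
  proof -
    obtain q p R where qp: "t = (q, p, R)" by (metis prod_cases3)
    obtain T where T: "T \<in> X" "t \<in> lifts n T" using t by (auto simp: D_def)
    then have "drawn_sym n t (K T) \<or> drawn_sym n t (uminus ` K T)"
      using K(1)[OF T(1)] drawn_sym_uminus unfolding lifts_def by blast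
    then obtain C f where "C = K T \<or> C = uminus ` K T" "q \<in> labels n" "p \<in> labels n"
      "descends (labels n) q p R f" "f (real_of_int p) = 0" "C = curve f q p"
      unfolding qp drawn_sym.simps by metis
    then have "P t f" using T unfolding P_def qp by auto
    then show ?thesis by (intro exI[of "P t" f])
  qed
  then have "\<forall>t\<in>D. \<exists>f. P t f" by blast
  then obtain F where F0: "\<forall>t\<in>D. P t (F t)" using bchoice by blast
  have F: "q \<in> labels n \<and> p \<in> labels n \<and> descends (labels n) q p R (F (q, p, R)) \<and>
      F (q, p, R) (real_of_int p) = 0 \<and>
      (\<exists>T\<in>X. (q, p, R) \<in> lifts n T \<and> (curve (F (q, p, R)) q p = K T \<or> curve (F (q, p, R)) q p = uminus ` K T))"
    if "(q, p, R) \<in> D" for q p R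
    using F0[rule_format, OF that] by (simp add: P_def)
  have drawn: "drawn_sym n (q, p, R) (curve (F (q, p, R)) q p)" if "(q, p, R) \<in> D" for q p R
    using F[OF that] by auto
  interpret noncrossing_curves n D F
  proof
    fix q p R q' p' R' y
    assume s: "(q, p, R) \<in> D" and t: "(q', p', R') \<in> D" and ne: "(q, p, R) \<noteq> (q', p', R')"
      and y: "real_of_int p \<le> y" "y \<le> real_of_int q" "real_of_int p' \<le> y" "y \<le> real_of_int q'"
      and eq: "F (q, p, R) y = F (q', p', R') y"
    define C C' where "C = curve (F (q, p, R)) q p" and "C' = curve (F (q', p', R')) q' p'"
    define x where "x = (F (q, p, R) y, y)"
    have x: "x \<in> C" "x \<in> C'" using y eq by (auto simp: x_def C_def C'_def in_curve_iff)
    obtain S where S: "S \<in> X" "(q, p, R) \<in> lifts n S" "C = K S \<or> C = uminus ` K S"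
      using F[OF s] unfolding C_def by blast
    obtain T where T: "T \<in> X" "(q', p', R') \<in> lifts n T" "C' = K T \<or> C' = uminus ` K T"
      using F[OF t] unfolding C'_def by blast
    have "C \<noteq> C'" using drawn_sym_unique drawn[OF s] drawn[OF t] ne unfolding C_def C'_def by metis
    \<comment> \<open>Different curves over one type-B arc are a lift and its half-turn, which are
      disjoint.\<close>
    have "S \<noteq> T"
    proof
      assume "S = T"
      then have "symmetric_or_disjoint (K S)" "x \<in> K S" "x \<in> uminus ` K S" "uminus ` K S \<noteq> K S"
        using S T K(3) x \<open>C \<noteq> C'\<close> by auto
      then show False by (auto simp: symmetric_or_disjoint_def)
    qed
    have "phi x \<in> A S" "phi x \<in> A T"
      using x S T K(2) phi_image_uminus by (metis imageI)+
    then obtain i where i: "phi x = Upper 0 (real_of_int i)" "i \<in> ends S \<inter> ends T"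
      using crossing[OF S(1) T(1) \<open>S \<noteq> T\<close>] by blast
    have "i \<in> {1..int n}"
      using i(2) A[OF S(1)] by (cases S) (auto simp: ends_def)
    then have "phi x = phi (0, real_of_int i)" using i(1) by simp
    then have "x = (0, real_of_int i) \<or> x = (0, real_of_int (- i))" unfolding phi_eq_iff by simp
    moreover have "i \<in> labels n" "- i \<in> labels n"
      using \<open>i \<in> {1..int n}\<close> by (auto simp: in_labels_iff)
    ultimately obtain j where j: "x = (0, real_of_int j)" "j \<in> labels n" by blast
    have "j \<in> {q, p} \<inter> {q', p'}"
      using label_on_drawn_sym[OF drawn[OF s], of j] label_on_drawn_sym[OF drawn[OF t], of j]
        x j unfolding C_def C'_def by simp
    moreover have "y = real_of_int j" using j(1) by (simp add: x_def)
    ultimately show "y \<in> real_of_int ` ({q, p} \<inter> {q', p'})" by blast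
  next
    fix q p R p' R' assume s: "(q, p, R) \<in> D" and t: "(q, p', R') \<in> D"
    obtain S T where S: "S \<in> X" "(q, p, R) \<in> lifts n S" and T: "T \<in> X" "(q, p', R') \<in> lifts n T"
      using s t by (auto simp: D_def)
    have "q \<noteq> 0" using F[OF s] by (auto simp: in_labels_iff)
    \<comment> \<open>A shared top is a shared downward end if it is positive and a shared upward
      end if it is negative; the diagram allows neither for distinct arcs.\<close>
    then have "q \<in> down_ends S \<inter> down_ends T \<or> - q \<in> up_ends S \<inter> up_ends T"
      using lift_ends(1,2)[OF A[OF S(1)] S(2)] lift_ends(1,2)[OF A[OF T(1)] T(2)] by force
    then have "S = T" using down up S(1) T(1) by blast
    then show "p = p' \<and> R = R'" using lifts_same_end[OF A[OF S(1)] S(2)] T(2) by auto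
  next
    fix q p R q' R' assume s: "(q, p, R) \<in> D" and t: "(q', p, R') \<in> D"
    obtain S T where S: "S \<in> X" "(q, p, R) \<in> lifts n S" and T: "T \<in> X" "(q', p, R') \<in> lifts n T"
      using s t by (auto simp: D_def)
    have "p \<noteq> 0" using F[OF s] by (auto simp: in_labels_iff)
    then have "p \<in> up_ends S \<inter> up_ends T \<or> - p \<in> down_ends S \<inter> down_ends T"
      using lift_ends(3,4)[OF A[OF S(1)] S(2)] lift_ends(3,4)[OF A[OF T(1)] T(2)] by force
    then have "S = T" using down up S(1) T(1) by blast
    then show "q = q' \<and> R = R'" using lifts_same_end[OF A[OF S(1)] S(2)] T(2) by auto
  qed (use F in auto)
  obtain \<pi> where \<pi>: "\<pi> permutes labels n" "delta n \<pi> = D" using exists_delta_eq by blast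
  have "neg_arc n ` D = D"
  proof -
    have "neg_arc n ` lifts n T = lifts n T" if "T \<in> X" for T
    proof -
      have "neg_arc n ` lifts n T = {neg_arc n (base_lift T), neg_arc n (neg_arc n (base_lift T))}"
        by (simp add: lifts_def)
      also have "\<dots> = lifts n T"
        by (rule lifts_eq[OF A[OF that], symmetric]) (simp add: lifts_def)
      finally show ?thesis .
    qed
    then show ?thesis by (simp add: D_def image_UN)
  qed
  then have "half_turn \<pi> = \<pi>"
    using delta_inject[OF half_turn_permutes[OF \<pi>(1)] \<pi>(1)] delta_half_turn[OF \<pi>(1)] \<pi>(2) by simp
  then have "\<pi> (- i) = - \<pi> i" for i by (metis half_turn_def minus_minus)
  then have signed: "\<pi> \<in> signed_perms n" using \<pi>(1) by (simp add: signed_perms_def)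
  have "T \<in> delta_orb n \<pi> \<longleftrightarrow> T \<in> X" for T
  proof
    assume "T \<in> X"
    then show "T \<in> delta_orb n \<pi>"
      unfolding delta_orb_iff[OF signed] \<pi>(2) D_def lifts_def using A by blast
  next
    assume "T \<in> delta_orb n \<pi>"
    then show "T \<in> X"
      unfolding delta_orb_iff[OF signed] \<pi>(2) D_def using A lifts_disjoint by blast
  qed
  then show ?thesis using signed by blast
qed

theorem theorem5p1:
  fixes n :: nat
  shows "bij_betw (delta_orb n) (signed_perms n) (typeB_diagrams n)"
proof (rule bij_betw_imageI)
  show "inj_on (delta_orb n) (signed_perms n)"
    by (rule inj_onI) (metis delta_eq_Union_lifts delta_inject signed_permsD(1))
  show "delta_orb n ` signed_perms n = typeB_diagrams n"
    using delta_orb_in_typeB_diagrams typeB_diagrams_surjective by blast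
qed

end
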